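(* Let $(X,f:X\to\mathcal{P}(\mathcal{D}X\times A))$ be a simple Segala system, where $A$ contains a distinguished action $\tau$. Then an equivalence relation $E\subseteq X\times X$ is a weak probabilistic bisimulation on $(X,f)$ if and only if $E$ is a $B$-$\sqcup$-bisimulation on the $\mathbb{C}$-coalgebra $(X,\kappa_X\circ f:X\to C_0M(X\times A))$, where $B$ is the weak observation pattern.
   Context: $\mathcal{D}X$: finitely supported $\xi:X\to[0,\infty)$ with $\sum_x\xi(x)=1$; $\delta_x$ point mass; operations on valuations pointwise. Write $x\xrightarrow{a}\xi$ iff $(\xi,a)\in f(x)$; a combined step $x\overset{a}{\rightsquigarrow}\xi$ means finitely many $x\xrightarrow{a}\xi_i$, $r_i\ge0$, $\sum r_i=1$, $\xi=\sum r_i\xi_i$. Weak transitions: $x\overset{a}{\Rightarrow}_0\xi$ iff $a=\tau$ and $\xi=\delta_x$; $x\overset{a}{\Rightarrow}_{n+1}\xi$ iff $\xi=\sum_y\big(p\,\zeta_a(y)\theta^\tau_y+(1-p)\zeta_\tau(y)\theta^a_y\big)$ with $p\in[0,1]$, $x\overset{a}{\rightsquigarrow}\zeta_a$, $x\overset{\tau}{\rightsquigarrow}\zeta_\tau$, $y\overset{a}{\Rightarrow}_n\theta^a_y$, $y\overset{\tau}{\Rightarrow}_n\theta^\tau_y$ for all $y$ ($\theta^a=\theta^\tau$ if $a=\tau$). $E$ is a weak probabilistic bisimulation if whenever $xEy$ and $x\xrightarrow{a}\xi$ there are $n,\xi'$ with $y\overset{a}{\Rightarrow}_n\xi'$ and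 $\sum_{z\in C}\xi(z)=\sum_{z\in C}\xi'(z)$ for all $E$-classes $C$. The monad $\mathbb{C}$: $C_0MY$ is the set of nonempty sets $M$ of finitely supported maps $Y\to[0,\infty)$ with $\sum_ip_i\xi_i\in M$ whenever finitely many $\xi_i\in M$, $p_i\ge0$, $\sum p_i\le1$; $\eta(y)=\{r\delta_y\mid r\in[0,1]\}$; for $g:Y\to C_0MZ$, $g^\dagger(S)=\{\sum_{y}\zeta(y)\theta_y\mid\zeta\in S,\ \theta_y\in g(y)\ \text{for all }y\}$. $C_0MY$ is ordered by inclusion (maps into it pointwise), with least element $\{0\}$; $M\sqcup N$ is the least element of $C_0MY$ containing $M\cup N$. $\kappa_X(S)=\{\lambda(x,a).\sum_ir_i\delta_{a,a_i}\xi_i(x)\mid$ finitely many $(\xi_i,a_i)\in S$, $r_i\ge0$, $\sum r_i\le1\}$, $\delta_{a,a'}=1$ iff $a=a'$ else $0$. The weak pattern is $B=\{\tau^*\}\cup\{\tau^*a\tau^*\mid a\in A\setminus\{\tau\}\}\cup\{\emptyset\}$, with derivatives $b/a=\{w\mid aw\in b\}$. For $h:X\to Y$ and coalgebra $k:X\to C_0M(X\times A)$, $k^B_h:X\to(C_0MY)^B$ is the least map with $k^B_h(x)(b)=e_b(x)\sqcup(\lambda(y,a).k^B_h(y)(b/a))^\dagger(k(x))$, $e_b(x)=\eta(h(x))$ if $\epsilon\in b$ and $\{0\}$ otherwise. $E$ is a $B$-$\sqcup$-bisimulation on $(X,k)$ if $k^B_\pi(x)=k^B_\pi(x')$ whenever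 $xEx'$, where $\pi:X\to X/E$ is the projection.
   Formalization: As written the equivalence fails; here the answering weak transitions may also idle (every state gets an extra silent step to its own point mass, allowing early halting), and the components ζ and θ_y are required only where their coefficient is nonzero. *)

theory Defs
  imports Complex_Main "HOL-Library.FuncSet" "HOL-Library.Groups_Big_Fun"
begin

text \<open>
  The state space and the action set are types. A valuation on a set \<open>Y\<close> is a real function
  on the ambient type that vanishes outside \<open>Y\<close>. Sums over all points are written with
  \<^const>\<open>Sum_any\<close>, which sums over the points where the summand is nonzero.
\<close>

definition valuations :: "'y set \<Rightarrow> ('y \<Rightarrow> real) set" where
  "valuations Y = {\<xi>. finite {y. \<xi> y \<noteq> 0} \<and> {y. \<xi> y \<noteq> 0} \<subseteq> Y \<and> (\<forall>y. 0 \<le> \<xi> y)}"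

definition dists :: "('x \<Rightarrow> real) set" where
  "dists = {\<xi> \<in> valuations UNIV. Sum_any \<xi> = 1}"

definition dirac :: "'y \<Rightarrow> 'y \<Rightarrow> real" where
  "dirac y = (\<lambda>z. if z = y then 1 else 0)"

definition mass :: "('x \<Rightarrow> real) \<Rightarrow> 'x set \<Rightarrow> real" where
  "mass \<xi> C = Sum_any (\<lambda>z. if z \<in> C then \<xi> z else 0)"


type_synonym ('x, 'a) segala = "'x \<Rightarrow> (('x \<Rightarrow> real) \<times> 'a) set"

definition segala_system :: "('x, 'a) segala \<Rightarrow> bool" where
  "segala_system f \<longleftrightarrow> (\<forall>x. f x \<subseteq> dists \<times> UNIV)"

definition combined_step :: "('x, 'a) segala \<Rightarrow> 'x \<Rightarrow> 'a \<Rightarrow> ('x \<Rightarrow> real) \<Rightarrow> bool" where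
  "combined_step f x a \<xi> \<longleftrightarrow>
     (\<exists>(n::nat) r \<xi>s. (\<forall>i<n. (\<xi>s i, a) \<in> f x \<and> 0 \<le> r i) \<and> (\<Sum>i<n. r i) = 1 \<and>
        \<xi> = (\<lambda>z. \<Sum>i<n. r i * \<xi>s i z))"

text \<open>
  A component of the sum is only required to exist if it occurs with a nonzero coefficient.
  Otherwise there would be no weak transition for a visible action at all, since no state has
  one at level \<open>0\<close>.
\<close>

primrec weak_trans ::
    "'a \<Rightarrow> ('x, 'a) segala \<Rightarrow> nat \<Rightarrow> 'x \<Rightarrow> 'a \<Rightarrow> ('x \<Rightarrow> real) \<Rightarrow> bool" where
  "weak_trans \<tau> f 0 = (\<lambda>x a \<xi>. a = \<tau> \<and> \<xi> = dirac x)"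
| "weak_trans \<tau> f (Suc n) = (\<lambda>x a \<xi>. \<exists>p \<zeta>a \<zeta>\<tau> \<theta>a \<theta>\<tau>. 0 \<le> p \<and> p \<le> 1 \<and>
     (p \<noteq> 0 \<longrightarrow> combined_step f x a \<zeta>a) \<and>
     (1 - p \<noteq> 0 \<longrightarrow> combined_step f x \<tau> \<zeta>\<tau>) \<and>
     (\<forall>y. p * \<zeta>a y \<noteq> 0 \<longrightarrow> weak_trans \<tau> f n y \<tau> (\<theta>\<tau> y)) \<and>
     (\<forall>y. (1 - p) * \<zeta>\<tau> y \<noteq> 0 \<longrightarrow> weak_trans \<tau> f n y a (\<theta>a y)) \<and>
     (a = \<tau> \<longrightarrow> \<theta>a = \<theta>\<tau>) \<and>
     \<xi> = (\<lambda>z. Sum_any (\<lambda>y. p * \<zeta>a y * \<theta>\<tau> y z + (1 - p) * \<zeta>\<tau> y * \<theta>a y z)))"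

text \<open>
  The recursion above makes all branches perform the same number of steps. A weak transition in
  the usual sense may halt at any time, at different depths on different branches and with some
  probability; so may the observations below, where the word \<open>\<epsilon>\<close> belongs to \<open>\<tau>\<^sup>*\<close>.
  Halting is obtained by letting every state idle with a silent step. Without it, the two kinds
  of bisimulation do not coincide.
\<close>

definition idle :: "'a \<Rightarrow> ('x, 'a) segala \<Rightarrow> ('x, 'a) segala" where
  "idle \<tau> f = (\<lambda>x. insert (dirac x, \<tau>) (f x))"

definition weak_prob_bisim :: "'a \<Rightarrow> ('x, 'a) segala \<Rightarrow> ('x \<times> 'x) set \<Rightarrow> bool" where
  "weak_prob_bisim \<tau> f E \<longleftrightarrow>
     (\<forall>x y a \<xi>. (x, y) \<in> E \<longrightarrow> (\<xi>, a) \<in> f x \<longrightarrow>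
        (\<exists>n \<xi>'. weak_trans \<tau> (idle \<tau> f) n y a \<xi>' \<and> (\<forall>C \<in> UNIV // E. mass \<xi> C = mass \<xi>' C)))"


definition C0M :: "'y set \<Rightarrow> ('y \<Rightarrow> real) set set" where
  "C0M Y = {M. M \<noteq> {} \<and> M \<subseteq> valuations Y \<and>
     (\<forall>(n::nat) p \<xi>. (\<forall>i<n. \<xi> i \<in> M \<and> 0 \<le> p i) \<and> (\<Sum>i<n. p i) \<le> 1 \<longrightarrow>
        (\<lambda>y. \<Sum>i<n. p i * \<xi> i y) \<in> M)}"

definition C_unit :: "'y \<Rightarrow> ('y \<Rightarrow> real) set" where
  "C_unit y = {\<lambda>z. r * dirac y z | r. 0 \<le> r \<and> r \<le> 1}"

definition C_ext :: "('y \<Rightarrow> ('z \<Rightarrow> real) set) \<Rightarrow> ('y \<Rightarrow> real) set \<Rightarrow> ('z \<Rightarrow> real) set" where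
  "C_ext g S = {\<lambda>z. Sum_any (\<lambda>y. \<zeta> y * \<theta> y z) | \<zeta> \<theta>. \<zeta> \<in> S \<and> (\<forall>y. \<theta> y \<in> g y)}"

definition C_join :: "'y set \<Rightarrow> ('y \<Rightarrow> real) set \<Rightarrow> ('y \<Rightarrow> real) set \<Rightarrow> ('y \<Rightarrow> real) set" where
  "C_join Y M N = (LEAST K. K \<in> C0M Y \<and> M \<union> N \<subseteq> K)"

definition kappa :: "(('x \<Rightarrow> real) \<times> 'a) set \<Rightarrow> ('x \<times> 'a \<Rightarrow> real) set" where
  "kappa S = {\<lambda>(x, a). \<Sum>i<n. r i * (if a = as i then 1 else 0) * \<xi>s i x | (n::nat) r \<xi>s as.
     (\<forall>i<n. (\<xi>s i, as i) \<in> S \<and> 0 \<le> r i) \<and> (\<Sum>i<n. r i) \<le> 1}"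


definition weak_pattern :: "'a \<Rightarrow> 'a list set set" where
  "weak_pattern \<tau> =
     {lists {\<tau>}} \<union>
     {{u @ [a] @ v | u v. u \<in> lists {\<tau>} \<and> v \<in> lists {\<tau>}} | a. a \<noteq> \<tau>} \<union>
     {{}}"

definition lang_quot :: "'a list set \<Rightarrow> 'a \<Rightarrow> 'a list set" where
  "lang_quot b a = {w. a # w \<in> b}"

definition obs_init :: "('x \<Rightarrow> 'y) \<Rightarrow> 'a list set \<Rightarrow> 'x \<Rightarrow> ('y \<Rightarrow> real) set" where
  "obs_init h b x = (if [] \<in> b then C_unit (h x) else {\<lambda>_. 0})"

text \<open>
  The exponent \<open>(C0M Y)\<^sup>B\<close> is the extensional function space, so that the order on total
  functions restricts to the pointwise order on maps from \<open>B\<close>.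
\<close>

definition obs_map :: "'a list set set \<Rightarrow> 'y set \<Rightarrow> ('x \<Rightarrow> 'y) \<Rightarrow> ('x \<Rightarrow> ('x \<times> 'a \<Rightarrow> real) set) \<Rightarrow>
    'x \<Rightarrow> 'a list set \<Rightarrow> ('y \<Rightarrow> real) set" where
  "obs_map B Y h k = (LEAST K. (\<forall>x. K x \<in> B \<rightarrow>\<^sub>E C0M Y) \<and>
     (\<forall>x. \<forall>b\<in>B. K x b =
        C_join Y (obs_init h b x) (C_ext (\<lambda>(y, a). K y (lang_quot b a)) (k x))))"

definition obs_bisim ::
    "'a list set set \<Rightarrow> ('x \<Rightarrow> ('x \<times> 'a \<Rightarrow> real) set) \<Rightarrow> ('x \<times> 'x) set \<Rightarrow> bool" where
  "obs_bisim B k E \<longleftrightarrow>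
     (\<forall>x x'. (x, x') \<in> E \<longrightarrow>
        obs_map B (UNIV // E) (\<lambda>x. E `` {x}) k x = obs_map B (UNIV // E) (\<lambda>x. E `` {x}) k x')"

end

theory Submission
  imports Defs
begin

text \<open>
  The least map \<open>k\<^sup>B\<^sub>h\<close> is described by an inductive predicate \<open>obs\<close>: observations are generated
  by \<open>0\<close>, by halting when \<open>\<epsilon> \<in> b\<close>, by performing one step, and by convex combination.

  A weak bisimulation preserves observations, by induction on their generation: a step
  \<open>x \<rightarrow> \<xi>\<close> followed by a kernel \<open>\<theta>\<close> is answered by a weak transition \<open>y \<Rightarrow> \<xi>'\<close> with the same class
  masses, followed by the class-wise average of \<open>\<theta>\<close>; and since \<open>b/\<tau> = b\<close> for every \<open>b\<close> in the weak
  pattern, prefixing a weak transition to observations yields an observation again.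

  Conversely, all observations have total mass at most \<open>1\<close>. An observation of mass exactly \<open>1\<close> can
  lose nothing along its generation, hence it is the image in \<open>X/E\<close> of a weak transition. This
  uses that the weak transitions of a fixed length form a convex set, and that idling brings
  finitely many of them to a common length. The image of a step \<open>x \<rightarrow> \<xi>\<close> has mass \<open>1\<close>, so every
  \<open>y\<close> with the same observations answers it.
\<close>

section \<open>Valuations\<close>

text \<open>Kleisli composition with a kernel \<open>\<theta>\<close>: the average of the
  \<open>\<theta> y\<close> under \<open>\<xi>\<close>. Only the values of \<open>\<theta>\<close>
  on the support of \<open>\<xi>\<close> matter.\<close>

definition bind :: "('y \<Rightarrow> real) \<Rightarrow> ('y \<Rightarrow> 'z \<Rightarrow> real) \<Rightarrow> 'z \<Rightarrow> real" where
  "bind \<xi> \<theta> = (\<lambda>z. Sum_any (\<lambda>y. \<xi> y * \<theta> y z))"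

lemma valuationsD:
  assumes "\<xi> \<in> valuations Y"
  shows "finite {y. \<xi> y \<noteq> 0}" "\<xi> y \<noteq> 0 \<Longrightarrow> y \<in> Y" "0 \<le> \<xi> y"
  using assms by (auto simp: valuations_def)

lemma zero_valuation: "(\<lambda>_. 0) \<in> valuations Y"
  by (simp add: valuations_def)

lemma dirac_valuation: "y \<in> Y \<Longrightarrow> dirac y \<in> valuations Y"
  by (auto simp: valuations_def dirac_def)

lemma lincomb_valuation:
  assumes "\<xi> \<in> valuations Y" "\<zeta> \<in> valuations Y" "0 \<le> s" "0 \<le> t"
  shows "(\<lambda>y. s * \<xi> y + t * \<zeta> y) \<in> valuations Y"
proof -
  have "{y. s * \<xi> y + t * \<zeta> y \<noteq> 0} \<subseteq> {y. \<xi> y \<noteq> 0} \<union> {y. \<zeta> y \<noteq> 0}"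
    by auto
  then show ?thesis
    using assms unfolding valuations_def by (auto intro: finite_subset)
qed

lemma scale_valuation: "\<xi> \<in> valuations Y \<Longrightarrow> 0 \<le> t \<Longrightarrow> (\<lambda>y. t * \<xi> y) \<in> valuations Y"
  using lincomb_valuation[of \<xi> Y \<xi> t 0] by simp

lemma add_valuation:
  "\<xi> \<in> valuations Y \<Longrightarrow> \<zeta> \<in> valuations Y \<Longrightarrow> (\<lambda>y. \<xi> y + \<zeta> y) \<in> valuations Y"
  using lincomb_valuation[of \<xi> Y \<zeta> 1 1] by simp

lemma bind_eq_sum:
  assumes "finite S" "{y. \<xi> y \<noteq> 0} \<subseteq> S"
  shows "bind \<xi> \<theta> z = (\<Sum>y\<in>S. \<xi> y * \<theta> y z)"
  unfolding bind_def using assms by (intro Sum_any.expand_superset) auto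

lemma bind_cong: "(\<And>y. \<xi> y \<noteq> 0 \<Longrightarrow> \<theta> y = \<theta>' y) \<Longrightarrow> bind \<xi> \<theta> = bind \<xi> \<theta>'"
proof -
  assume *: "\<And>y. \<xi> y \<noteq> 0 \<Longrightarrow> \<theta> y = \<theta>' y"
  have "\<xi> y * \<theta> y z = \<xi> y * \<theta>' y z" for y z
    using * by (cases "\<xi> y = 0") auto
  then show ?thesis unfolding bind_def by presburger
qed

lemma bind_zero: "bind (\<lambda>_. 0) \<theta> = (\<lambda>_. 0)"
  by (simp add: bind_def)

lemma bind_dirac: "bind (dirac y) \<theta> = \<theta> y"
  by (rule ext, subst bind_eq_sum[of "{y}"]) (auto simp: dirac_def)

lemma bind_lincomb:
  assumes "\<xi> \<in> valuations Y" "\<zeta> \<in> valuations Z"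
  shows "bind (\<lambda>y. s * \<xi> y + t * \<zeta> y) \<theta> = (\<lambda>z. s * bind \<xi> \<theta> z + t * bind \<zeta> \<theta> z)"
proof
  fix z
  let ?S = "{y. \<xi> y \<noteq> 0} \<union> {y. \<zeta> y \<noteq> 0}"
  have fin: "finite ?S" using valuationsD(1)[OF assms(1)] valuationsD(1)[OF assms(2)] by simp
  have "bind (\<lambda>y. s * \<xi> y + t * \<zeta> y) \<theta> z = (\<Sum>y\<in>?S. (s * \<xi> y + t * \<zeta> y) * \<theta> y z)"
    using fin by (intro bind_eq_sum) auto
  also have "\<dots> = s * (\<Sum>y\<in>?S. \<xi> y * \<theta> y z) + t * (\<Sum>y\<in>?S. \<zeta> y * \<theta> y z)"
    by (simp add: sum_distrib_left sum.distrib algebra_simps)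
  also have "(\<Sum>y\<in>?S. \<xi> y * \<theta> y z) = bind \<xi> \<theta> z"
    using fin by (intro bind_eq_sum[symmetric]) auto
  also have "(\<Sum>y\<in>?S. \<zeta> y * \<theta> y z) = bind \<zeta> \<theta> z"
    using fin by (intro bind_eq_sum[symmetric]) auto
  finally show "bind (\<lambda>y. s * \<xi> y + t * \<zeta> y) \<theta> z = s * bind \<xi> \<theta> z + t * bind \<zeta> \<theta> z" .
qed

lemma bind_add:
  "\<xi> \<in> valuations Y \<Longrightarrow> \<zeta> \<in> valuations Z \<Longrightarrow>
    bind (\<lambda>y. \<xi> y + \<zeta> y) \<theta> = (\<lambda>z. bind \<xi> \<theta> z + bind \<zeta> \<theta> z)"
  using bind_lincomb[of \<xi> Y \<zeta> Z 1 1 \<theta>] by simp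

lemma bind_scale:
  "\<xi> \<in> valuations Y \<Longrightarrow> bind (\<lambda>y. t * \<xi> y) \<theta> = (\<lambda>z. t * bind \<xi> \<theta> z)"
  using bind_lincomb[of \<xi> Y \<xi> Y t 0 \<theta>] by simp

lemma bind_valuation:
  assumes "\<xi> \<in> valuations X" "\<And>y. \<xi> y \<noteq> 0 \<Longrightarrow> \<theta> y \<in> valuations Y"
  shows "bind \<xi> \<theta> \<in> valuations Y"
proof -
  let ?S = "{y. \<xi> y \<noteq> 0}"
  have fin: "finite ?S" using valuationsD(1)[OF assms(1)] .
  have eq: "bind \<xi> \<theta> z = (\<Sum>y\<in>?S. \<xi> y * \<theta> y z)" for z
    using fin by (intro bind_eq_sum) auto
  have sub: "{z. bind \<xi> \<theta> z \<noteq> 0} \<subseteq> (\<Union>y\<in>?S. {z. \<theta> y z \<noteq> 0})"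
  proof
    fix z assume "z \<in> {z. bind \<xi> \<theta> z \<noteq> 0}"
    then have "(\<Sum>y\<in>?S. \<xi> y * \<theta> y z) \<noteq> 0" using eq by simp
    then obtain y where "y \<in> ?S" "\<xi> y * \<theta> y z \<noteq> 0" by (meson sum.neutral)
    then show "z \<in> (\<Union>y\<in>?S. {z. \<theta> y z \<noteq> 0})" by auto
  qed
  have "finite (\<Union>y\<in>?S. {z. \<theta> y z \<noteq> 0})"
    using fin valuationsD(1)[OF assms(2)] by auto
  moreover have "(\<Union>y\<in>?S. {z. \<theta> y z \<noteq> 0}) \<subseteq> Y"
    using valuationsD(2)[OF assms(2)] by blast
  moreover have "0 \<le> bind \<xi> \<theta> z" for z
    unfolding eq using valuationsD(3)[OF assms(1)] valuationsD(3)[OF assms(2)]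
    by (intro sum_nonneg) simp
  ultimately show ?thesis
    using sub unfolding valuations_def by (auto intro: finite_subset)
qed

lemma bind_assoc:
  assumes "\<xi> \<in> valuations X" "\<And>y. \<xi> y \<noteq> 0 \<Longrightarrow> \<omega> y \<in> valuations Y"
  shows "bind (bind \<xi> \<omega>) \<theta> = bind \<xi> (\<lambda>y. bind (\<omega> y) \<theta>)"
proof
  fix z
  let ?S = "{y. \<xi> y \<noteq> 0}"
  \<comment> \<open>One finite set containing the supports of all the \<open>\<omega> y\<close>
    involved, so that the inner index set does not depend on \<open>y\<close> and the sums can be
    swapped.\<close>
  let ?T = "\<Union>y\<in>?S. {u. \<omega> y u \<noteq> 0}"
  have fin: "finite ?S" using valuationsD(1)[OF assms(1)] .
  have finT: "finite ?T" using fin valuationsD(1)[OF assms(2)] by auto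
  have eq: "bind \<xi> \<omega> u = (\<Sum>y\<in>?S. \<xi> y * \<omega> y u)" for u
    using fin by (intro bind_eq_sum) auto
  have sub: "{u. bind \<xi> \<omega> u \<noteq> 0} \<subseteq> ?T"
  proof
    fix u assume "u \<in> {u. bind \<xi> \<omega> u \<noteq> 0}"
    then have "(\<Sum>y\<in>?S. \<xi> y * \<omega> y u) \<noteq> 0" using eq by simp
    then obtain y where "y \<in> ?S" "\<xi> y * \<omega> y u \<noteq> 0" by (meson sum.neutral)
    then show "u \<in> ?T" by auto
  qed
  have "bind (bind \<xi> \<omega>) \<theta> z = (\<Sum>u\<in>?T. (\<Sum>y\<in>?S. \<xi> y * \<omega> y u) * \<theta> u z)"
    by (subst bind_eq_sum[OF finT sub]) (simp only: eq)
  also have "\<dots> = (\<Sum>y\<in>?S. \<xi> y * (\<Sum>u\<in>?T. \<omega> y u * \<theta> u z))"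
    by (simp add: sum_distrib_left sum_distrib_right mult.assoc) (rule sum.swap)
  also have "\<dots> = (\<Sum>y\<in>?S. \<xi> y * bind (\<omega> y) \<theta> z)"
  proof (rule sum.cong[OF refl])
    fix y assume "y \<in> ?S"
    then have "bind (\<omega> y) \<theta> z = (\<Sum>u\<in>?T. \<omega> y u * \<theta> u z)"
      using finT by (intro bind_eq_sum) auto
    then show "\<xi> y * (\<Sum>u\<in>?T. \<omega> y u * \<theta> u z) = \<xi> y * bind (\<omega> y) \<theta> z" by simp
  qed
  also have "\<dots> = bind \<xi> (\<lambda>y. bind (\<omega> y) \<theta>) z"
    using fin by (intro bind_eq_sum[symmetric]) auto
  finally show "bind (bind \<xi> \<omega>) \<theta> z = bind \<xi> (\<lambda>y. bind (\<omega> y) \<theta>) z" .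
qed

text \<open>Total mass is the image under the map to a one-point type. Linearity and the mass of a
  composite are thus instances of the laws of \<open>bind\<close>.\<close>

lemma Sum_any_eq_bind: "Sum_any \<xi> = bind \<xi> (\<lambda>_ _. 1) ()"
  by (simp add: bind_def)

lemma Sum_any_lincomb:
  "\<xi> \<in> valuations Y \<Longrightarrow> \<zeta> \<in> valuations Z \<Longrightarrow>
    Sum_any (\<lambda>y. s * \<xi> y + t * \<zeta> y) = s * Sum_any \<xi> + t * Sum_any \<zeta>"
  by (simp add: Sum_any_eq_bind bind_lincomb)

lemma Sum_any_bind:
  assumes "\<xi> \<in> valuations X" "\<And>y. \<xi> y \<noteq> 0 \<Longrightarrow> \<theta> y \<in> valuations Y"
  shows "Sum_any (bind \<xi> \<theta>) = Sum_any (\<lambda>y. \<xi> y * Sum_any (\<theta> y))"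
  by (simp add: Sum_any_eq_bind bind_assoc[OF assms]) (simp add: bind_def)

lemma Sum_any_dirac: "Sum_any (dirac y) = 1"
  by (simp add: Sum_any_eq_bind bind_dirac)

lemma distsD: "\<xi> \<in> dists \<Longrightarrow> \<xi> \<in> valuations UNIV" "\<xi> \<in> dists \<Longrightarrow> Sum_any \<xi> = 1"
  by (auto simp: dists_def)

lemma dirac_dist: "dirac x \<in> dists"
  by (simp add: dists_def dirac_valuation Sum_any_dirac)

section \<open>Convex combinations\<close>

text \<open>Nonnegative combinations of \<open>G\<close> with their total weight \<open>p\<close>
  kept as an index: one notion for combined steps (\<open>p = 1\<close>) and for \<open>C0M\<close>
  and \<open>kappa\<close> (\<open>p \<le> 1\<close>), and one that admits induction in place of
  indexed families.\<close>

inductive mix :: "('y \<Rightarrow> real) set \<Rightarrow> real \<Rightarrow> ('y \<Rightarrow> real) \<Rightarrow> bool" for G where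
  mix_zero: "mix G 0 (\<lambda>_. 0)"
| mix_step: "mix G p \<alpha> \<Longrightarrow> g \<in> G \<Longrightarrow> 0 \<le> r \<Longrightarrow> mix G (p + r) (\<lambda>z. \<alpha> z + r * g z)"

lemma mix_iff:
  "mix G p \<alpha> \<longleftrightarrow> (\<exists>(n::nat) r g. (\<forall>i<n. g i \<in> G \<and> 0 \<le> r i) \<and> (\<Sum>i<n. r i) = p \<and>
     \<alpha> = (\<lambda>z. \<Sum>i<n. r i * g i z))" (is "_ \<longleftrightarrow> ?R p \<alpha>")
proof
  assume "mix G p \<alpha>"
  then show "?R p \<alpha>"
  proof induction
    case mix_zero
    show ?case by (rule exI[of _ 0]) simp
  next
    case (mix_step p \<alpha> h s)
    then obtain n r g where *: "\<forall>i<n. g i \<in> G \<and> 0 \<le> r i" "(\<Sum>i<n. r i) = p"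
      "\<alpha> = (\<lambda>z. \<Sum>i<(n::nat). r i * g i z)" by auto
    show ?case
    proof (intro exI conjI)
      show "\<forall>i<Suc n. (g(n := h)) i \<in> G \<and> 0 \<le> (r(n := s)) i"
        using * mix_step.hyps by (auto simp: less_Suc_eq)
    qed (use * in auto)
  qed
next
  assume "?R p \<alpha>"
  then obtain n r g where *: "\<forall>i<n. g i \<in> G \<and> 0 \<le> r i" "(\<Sum>i<n. r i) = p"
    "\<alpha> = (\<lambda>z. \<Sum>i<(n::nat). r i * g i z)" by auto
  have "mix G (\<Sum>i<n. r i) (\<lambda>z. \<Sum>i<n. r i * g i z)"
    using *(1)
  proof (induction n)
    case 0
    show ?case using mix_zero by simp
  next
    case (Suc n)
    then show ?case using mix_step[of G "\<Sum>i<n. r i" _ "g n" "r n"] by simp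
  qed
  then show "mix G p \<alpha>" using * by simp
qed

lemma mix_single: "g \<in> G \<Longrightarrow> 0 \<le> r \<Longrightarrow> mix G r (\<lambda>z. r * g z)"
  using mix_step[OF mix_zero, of g G r] by simp

lemma mix_single_one: "g \<in> G \<Longrightarrow> mix G 1 g"
  using mix_single[of g G 1] by simp

lemma mix_nonneg: "mix G p \<alpha> \<Longrightarrow> 0 \<le> p"
  by (induction rule: mix.induct) auto

lemma mix_scale:
  assumes "mix G p \<alpha>" "0 \<le> t"
  shows "mix G (t * p) (\<lambda>z. t * \<alpha> z)"
  using assms(1)
proof induction
  case mix_zero
  show ?case using mix.mix_zero by simp
next
  case (mix_step p \<alpha> g r)
  then have "mix G (t * p + t * r) (\<lambda>z. t * \<alpha> z + (t * r) * g z)"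
    using assms(2) by (intro mix.mix_step) auto
  then show ?case by (simp add: algebra_simps)
qed

lemma mix_add:
  assumes "mix G p \<alpha>" "mix G q \<beta>"
  shows "mix G (p + q) (\<lambda>z. \<alpha> z + \<beta> z)"
  using assms(2)
proof induction
  case mix_zero
  show ?case using assms(1) by simp
next
  case (mix_step q \<beta> g r)
  then have "mix G ((p + q) + r) (\<lambda>z. (\<alpha> z + \<beta> z) + r * g z)"
    by (intro mix.mix_step) auto
  then show ?case by (simp add: algebra_simps)
qed

lemma mix_sum:
  assumes "finite S" "\<And>i. i \<in> S \<Longrightarrow> g i \<in> G \<and> 0 \<le> r i"
  shows "mix G (\<Sum>i\<in>S. r i) (\<lambda>z. \<Sum>i\<in>S. r i * g i z)"
  using assms
proof (induction S rule: finite_induct)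
  case empty
  then show ?case using mix_zero by simp
next
  case (insert i S)
  then show ?case
    using mix_add[OF mix_single[of "g i" G "r i"], of "sum r S" "\<lambda>z. \<Sum>i\<in>S. r i * g i z"] by simp
qed

lemma mix_zero_weight:
  assumes "mix G p \<alpha>" "p = 0"
  shows "\<alpha> = (\<lambda>_. 0)"
  using assms
proof induction
  case (mix_step p \<alpha> g r)
  then have "p = 0" "r = 0" using mix_nonneg[of G p \<alpha>] by auto
  then show ?case using mix_step by simp
qed simp

lemma mix_valuation: "mix G p \<alpha> \<Longrightarrow> G \<subseteq> valuations Y \<Longrightarrow> \<alpha> \<in> valuations Y"
proof (induction rule: mix.induct)
  case mix_zero
  show ?case by (rule zero_valuation)
next
  case (mix_step p \<alpha> g r)
  then show ?case using lincomb_valuation[of \<alpha> Y g 1 r] by auto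
qed

lemma mix_bind:
  assumes "mix G p \<alpha>" "G \<subseteq> valuations Y" "\<And>g. g \<in> G \<Longrightarrow> bind g \<theta> \<in> H"
  shows "mix H p (bind \<alpha> \<theta>)"
  using assms(1)
proof induction
  case mix_zero
  show ?case using mix.mix_zero by (simp add: bind_zero)
next
  case (mix_step p \<alpha> g r)
  have "bind (\<lambda>z. \<alpha> z + r * g z) \<theta> = (\<lambda>z. bind \<alpha> \<theta> z + r * bind g \<theta> z)"
    using bind_lincomb[of \<alpha> Y g Y 1 r \<theta>] mix_valuation mix_step assms(2) by fastforce
  then show ?case using mix_step assms(3) mix.mix_step[of H p "bind \<alpha> \<theta>" "bind g \<theta>" r] by simp
qed

section \<open>Convex sets and the carrier of the monad\<close>

definition convex :: "('y \<Rightarrow> real) set \<Rightarrow> bool" where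
  "convex M \<longleftrightarrow> (\<forall>g\<in>M. \<forall>h\<in>M. \<forall>t. 0 \<le> t \<longrightarrow> t \<le> 1 \<longrightarrow> (\<lambda>z. t * g z + (1 - t) * h z) \<in> M)"

lemma convexD:
  "convex M \<Longrightarrow> g \<in> M \<Longrightarrow> h \<in> M \<Longrightarrow> 0 \<le> t \<Longrightarrow> t \<le> 1 \<Longrightarrow>
    (\<lambda>z. t * g z + (1 - t) * h z) \<in> M"
  by (auto simp: convex_def)

lemma convexD_weights:
  assumes "convex M" "g \<in> M" "h \<in> M" "0 \<le> p" "0 \<le> q" "p + q > 0"
  shows "(\<lambda>z. (p * g z + q * h z) / (p + q)) \<in> M"
proof -
  have "(\<lambda>z. (p / (p + q)) * g z + (1 - p / (p + q)) * h z) \<in> M"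
    using assms by (intro convexD) auto
  moreover have "1 - p / (p + q) = q / (p + q)"
    using assms(6) by (simp add: field_simps)
  ultimately show ?thesis by (simp add: add_divide_distrib)
qed

text \<open>Binary convexity yields all finite combinations: by induction the combination built so
  far, divided by its weight, stays in \<open>M\<close>.\<close>

lemma mix_convex:
  assumes "mix M p \<alpha>" "convex M" "p > 0"
  shows "(\<lambda>z. \<alpha> z / p) \<in> M"
  using assms(1,3)
proof induction
  case mix_zero
  then show ?case by simp
next
  case (mix_step p \<alpha> g r)
  show ?case
  proof (cases "p = 0")
    \<comment> \<open>Up to here nothing has positive weight, so the normalised combination is
      \<open>g\<close> itself.\<close>
    case True
    then show ?thesis using mix_step mix_zero_weight[OF mix_step.hyps(1) True] by simp
  next
    case False
    then have "p > 0" using mix_nonneg[OF mix_step.hyps(1)] by simp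
    with mix_step.IH have *: "(\<lambda>z. \<alpha> z / p) \<in> M" by simp
    show ?thesis
      using convexD_weights[OF assms(2) * mix_step.hyps(2), of p r] \<open>p > 0\<close> mix_step by simp
  qed
qed

lemma mix_one_convex: "mix M 1 \<alpha> \<Longrightarrow> convex M \<Longrightarrow> \<alpha> \<in> M"
  using mix_convex[of M 1 \<alpha>] by simp

text \<open>The missing weight \<open>1 - p\<close> is put on 0.\<close>

lemma mix_subconvex:
  assumes "mix M p \<alpha>" "p \<le> 1" "convex M" "(\<lambda>_. 0) \<in> M"
  shows "\<alpha> \<in> M"
proof (cases "p = 0")
  case True
  then show ?thesis using mix_zero_weight assms by blast
next
  case False
  then have "p > 0" using mix_nonneg[OF assms(1)] by simp
  with convexD[OF assms(3) mix_convex[OF assms(1,3)] assms(4), of p] assms(2)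
  show ?thesis by simp
qed

text \<open>The empty combination produces 0, and conversely 0 absorbs missing weight, so subconvex
  closure amounts to convexity together with 0.\<close>

lemma C0M_iff:
  "M \<in> C0M Y \<longleftrightarrow> (\<lambda>_. 0) \<in> M \<and> M \<subseteq> valuations Y \<and> convex M"
proof
  assume M: "M \<in> C0M Y"
  then have closed: "\<alpha> \<in> M" if "mix M p \<alpha>" "p \<le> 1" for p \<alpha>
    using that unfolding C0M_def mix_iff by blast
  have "convex M"
    unfolding convex_def
  proof (intro ballI allI impI)
    fix g h and t :: real assume "g \<in> M" "h \<in> M" "0 \<le> t" "t \<le> 1"
    then have "mix M (t + (1 - t)) (\<lambda>z. t * g z + (1 - t) * h z)"
      by (intro mix_add mix_single) auto
    then show "(\<lambda>z. t * g z + (1 - t) * h z) \<in> M" by (rule closed) simp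
  qed
  moreover have "(\<lambda>_. 0) \<in> M" by (rule closed[OF mix_zero]) simp
  ultimately show "(\<lambda>_. 0) \<in> M \<and> M \<subseteq> valuations Y \<and> convex M"
    using M by (simp add: C0M_def)
next
  assume M: "(\<lambda>_. 0) \<in> M \<and> M \<subseteq> valuations Y \<and> convex M"
  have "(\<lambda>y. \<Sum>i<n. p i * \<xi> i y) \<in> M"
    if "(\<forall>i<n. \<xi> i \<in> M \<and> 0 \<le> p i) \<and> (\<Sum>i<n. p i) \<le> 1" for n :: nat and p \<xi>
    using that M by (intro mix_subconvex[OF mix_sum]) auto
  then show "M \<in> C0M Y" using M unfolding C0M_def by blast
qed

text \<open>Two kernels used with different valuations become one kernel for the sum: at each
  \<open>y\<close> take the average of \<open>\<theta> y\<close> and \<open>\<phi> y\<close> with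
  weights \<open>\<alpha> y\<close> and \<open>\<beta> y\<close>.\<close>

lemma bind_merge:
  assumes "\<alpha> \<in> valuations X" "\<beta> \<in> valuations X" "\<And>y. convex (M y)"
    and "\<And>y. \<alpha> y \<noteq> 0 \<Longrightarrow> \<theta> y \<in> M y" "\<And>y. \<beta> y \<noteq> 0 \<Longrightarrow> \<phi> y \<in> M y"
  shows "\<exists>\<psi>. (\<forall>y. \<alpha> y + \<beta> y \<noteq> 0 \<longrightarrow> \<psi> y \<in> M y) \<and>
    (\<lambda>z. bind \<alpha> \<theta> z + bind \<beta> \<phi> z) = bind (\<lambda>y. \<alpha> y + \<beta> y) \<psi>"
proof -
  \<comment> \<open>Where both weights vanish, division by zero makes this 0; membership in
    \<open>M y\<close> is claimed only elsewhere.\<close>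
  define \<psi> where "\<psi> y = (\<lambda>z. (\<alpha> y * \<theta> y z + \<beta> y * \<phi> y z) / (\<alpha> y + \<beta> y))" for y
  have nn: "0 \<le> \<alpha> y" "0 \<le> \<beta> y" for y using valuationsD(3)[OF assms(1)] valuationsD(3)[OF assms(2)] by auto
  have in_M: "\<psi> y \<in> M y" if nz: "\<alpha> y + \<beta> y \<noteq> 0" for y
  proof -
    \<comment> \<open>A kernel value of weight zero need not lie in \<open>M y\<close>, so convexity
      can be applied only when both weights are positive.\<close>
    consider "\<alpha> y = 0" "\<beta> y \<noteq> 0" | "\<alpha> y \<noteq> 0" "\<beta> y = 0" | "\<alpha> y \<noteq> 0" "\<beta> y \<noteq> 0"
      using nz by force
    then show ?thesis
    proof cases
      case 3
      then show ?thesis unfolding \<psi>_def using assms nn[of y]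
        by (intro convexD_weights) auto
    qed (use assms in \<open>auto simp: \<psi>_def\<close>)
  qed
  have eq: "bind \<alpha> \<theta> z + bind \<beta> \<phi> z = bind (\<lambda>y. \<alpha> y + \<beta> y) \<psi> z" for z
  proof -
    let ?S = "{y. \<alpha> y \<noteq> 0} \<union> {y. \<beta> y \<noteq> 0}"
    have fin: "finite ?S" using valuationsD(1)[OF assms(1)] valuationsD(1)[OF assms(2)] by simp
    have pt: "\<alpha> y * \<theta> y z + \<beta> y * \<phi> y z = (\<alpha> y + \<beta> y) * \<psi> y z" for y
    proof (cases "\<alpha> y + \<beta> y = 0")
      case True
      then have "\<alpha> y = 0" "\<beta> y = 0" using nn[of y] by auto
      then show ?thesis by simp
    qed (simp add: \<psi>_def)
    have "bind \<alpha> \<theta> z = (\<Sum>y\<in>?S. \<alpha> y * \<theta> y z)" "bind \<beta> \<phi> z = (\<Sum>y\<in>?S. \<beta> y * \<phi> y z)"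
      "bind (\<lambda>y. \<alpha> y + \<beta> y) \<psi> z = (\<Sum>y\<in>?S. (\<alpha> y + \<beta> y) * \<psi> y z)"
      by (rule bind_eq_sum[OF fin]; auto)+
    then show ?thesis by (simp add: sum.distrib[symmetric] pt)
  qed
  show ?thesis using in_M eq by blast
qed

section \<open>Weak transitions\<close>

definition steps :: "('x, 'a) segala \<Rightarrow> 'x \<Rightarrow> 'a \<Rightarrow> ('x \<Rightarrow> real) set" where
  "steps f x a = {\<xi>. (\<xi>, a) \<in> f x}"

lemma combined_step_iff: "combined_step f x a \<xi> \<longleftrightarrow> mix (steps f x a) 1 \<xi>"
  unfolding combined_step_def mix_iff steps_def by simp

lemma segala_dists: "segala_system f \<Longrightarrow> (\<xi>, a) \<in> f x \<Longrightarrow> \<xi> \<in> dists"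
  by (auto simp: segala_system_def)

lemma steps_valuations: "segala_system f \<Longrightarrow> steps f x a \<subseteq> valuations UNIV"
  by (auto simp: steps_def dest: segala_dists distsD(1))

lemma segala_idle: "segala_system f \<Longrightarrow> segala_system (idle \<tau> f)"
  by (auto simp: segala_system_def idle_def dirac_dist)

text \<open>Absorbing the weights \<open>p\<close> and \<open>1 - p\<close> into the valuations
  removes the side conditions of the recursion: a branch that does not occur is the zero
  valuation.\<close>

lemma weak_trans_SucD:
  assumes "segala_system f" "weak_trans \<tau> f (Suc n) x a \<xi>"
  shows "\<exists>p \<alpha> \<beta> \<theta>\<tau> \<theta>a. mix (steps f x a) p \<alpha> \<and> mix (steps f x \<tau>) (1 - p) \<beta> \<and>
    (\<forall>y. \<alpha> y \<noteq> 0 \<longrightarrow> weak_trans \<tau> f n y \<tau> (\<theta>\<tau> y)) \<and>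
    (\<forall>y. \<beta> y \<noteq> 0 \<longrightarrow> weak_trans \<tau> f n y a (\<theta>a y)) \<and>
    \<xi> = (\<lambda>z. bind \<alpha> \<theta>\<tau> z + bind \<beta> \<theta>a z)"
proof -
  obtain p \<zeta>a \<zeta>\<tau> \<theta>a \<theta>\<tau> where *: "0 \<le> p" "p \<le> 1"
     "p \<noteq> 0 \<longrightarrow> combined_step f x a \<zeta>a" "1 - p \<noteq> 0 \<longrightarrow> combined_step f x \<tau> \<zeta>\<tau>"
     "\<forall>y. p * \<zeta>a y \<noteq> 0 \<longrightarrow> weak_trans \<tau> f n y \<tau> (\<theta>\<tau> y)"
     "\<forall>y. (1 - p) * \<zeta>\<tau> y \<noteq> 0 \<longrightarrow> weak_trans \<tau> f n y a (\<theta>a y)"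
     and \<xi>: "\<xi> = (\<lambda>z. Sum_any (\<lambda>y. p * \<zeta>a y * \<theta>\<tau> y z + (1 - p) * \<zeta>\<tau> y * \<theta>a y z))"
    using assms(2) unfolding weak_trans.simps by blast
  define \<alpha> \<beta> where "\<alpha> y = p * \<zeta>a y" and "\<beta> y = (1 - p) * \<zeta>\<tau> y" for y
  have a: "mix (steps f x a) p \<alpha>"
    using *(1,3) mix_scale[of "steps f x a" 1 \<zeta>a p] mix_zero
    unfolding \<alpha>_def combined_step_iff by (cases "p = 0") auto
  have b: "mix (steps f x \<tau>) (1 - p) \<beta>"
    using *(2,4) mix_scale[of "steps f x \<tau>" 1 \<zeta>\<tau> "1 - p"] mix_zero
    unfolding \<beta>_def combined_step_iff by (cases "p = 1") auto
  have va: "\<alpha> \<in> valuations UNIV" and vb: "\<beta> \<in> valuations UNIV"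
    using mix_valuation[OF a] mix_valuation[OF b] steps_valuations[OF assms(1)] by auto
  let ?S = "{y. \<alpha> y \<noteq> 0} \<union> {y. \<beta> y \<noteq> 0}"
  have fin: "finite ?S" using valuationsD(1)[OF va] valuationsD(1)[OF vb] by simp
  have "\<xi> z = bind \<alpha> \<theta>\<tau> z + bind \<beta> \<theta>a z" for z
  proof -
    have "\<xi> z = (\<Sum>y\<in>?S. \<alpha> y * \<theta>\<tau> y z + \<beta> y * \<theta>a y z)"
      unfolding \<xi> \<alpha>_def[symmetric] \<beta>_def[symmetric] using fin
      by (intro Sum_any.expand_superset) auto
    moreover have "bind \<alpha> \<theta>\<tau> z = (\<Sum>y\<in>?S. \<alpha> y * \<theta>\<tau> y z)" "bind \<beta> \<theta>a z = (\<Sum>y\<in>?S. \<beta> y * \<theta>a y z)"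
      by (rule bind_eq_sum[OF fin]; auto)+
    ultimately show ?thesis by (simp add: sum.distrib)
  qed
  moreover have "\<forall>y. \<alpha> y \<noteq> 0 \<longrightarrow> weak_trans \<tau> f n y \<tau> (\<theta>\<tau> y)"
    "\<forall>y. \<beta> y \<noteq> 0 \<longrightarrow> weak_trans \<tau> f n y a (\<theta>a y)"
    using *(5,6) unfolding \<alpha>_def \<beta>_def by auto
  ultimately show ?thesis using a b by blast
qed

lemma weak_trans_valuation:
  assumes "segala_system f" "weak_trans \<tau> f n x a \<xi>"
  shows "\<xi> \<in> valuations UNIV"
  using assms(2)
proof (induction n arbitrary: x a \<xi>)
  case 0
  then show ?case by (simp add: dirac_valuation)
next
  case (Suc n)
  obtain p \<alpha> \<beta> \<theta>a \<theta>\<tau> where *: "mix (steps f x a) p \<alpha>" "mix (steps f x \<tau>) (1 - p) \<beta>"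
    "\<And>y. \<alpha> y \<noteq> 0 \<Longrightarrow> weak_trans \<tau> f n y \<tau> (\<theta>\<tau> y)"
    "\<And>y. \<beta> y \<noteq> 0 \<Longrightarrow> weak_trans \<tau> f n y a (\<theta>a y)"
    "\<xi> = (\<lambda>z. bind \<alpha> \<theta>\<tau> z + bind \<beta> \<theta>a z)" using weak_trans_SucD[OF assms(1) Suc.prems] by blast
  have "\<alpha> \<in> valuations UNIV" "\<beta> \<in> valuations UNIV"
    using *(1,2)[THEN mix_valuation, OF steps_valuations[OF assms(1)]] by auto
  moreover have "\<theta>\<tau> y \<in> valuations UNIV" if "\<alpha> y \<noteq> 0" for y using Suc.IH[OF *(3)[OF that]] .
  moreover have "\<theta>a y \<in> valuations UNIV" if "\<beta> y \<noteq> 0" for y using Suc.IH[OF *(4)[OF that]] .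
  ultimately show ?case unfolding *(5) by (intro add_valuation bind_valuation[where X = UNIV])
qed

text \<open>For \<open>a = \<tau>\<close> the recursion demands a single kernel, obtained from the
  two given ones by \<open>bind_merge\<close>. This is why convexity at level \<open>n\<close> is
  assumed; it is established below by an induction that uses this lemma for its step.\<close>

lemma weak_trans_SucI:
  assumes f: "segala_system f" and conv: "\<And>y. convex {\<xi>. weak_trans \<tau> f n y \<tau> \<xi>}"
    and a: "mix (steps f x a) p \<alpha>" and b: "mix (steps f x \<tau>) (1 - p) \<beta>"
    and \<theta>\<tau>: "\<And>y. \<alpha> y \<noteq> 0 \<Longrightarrow> weak_trans \<tau> f n y \<tau> (\<theta>\<tau> y)"
    and \<theta>a: "\<And>y. \<beta> y \<noteq> 0 \<Longrightarrow> weak_trans \<tau> f n y a (\<theta>a y)"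
  shows "weak_trans \<tau> f (Suc n) x a (\<lambda>z. bind \<alpha> \<theta>\<tau> z + bind \<beta> \<theta>a z)"
proof -
  have va: "\<alpha> \<in> valuations UNIV" and vb: "\<beta> \<in> valuations UNIV"
    using mix_valuation[OF a] mix_valuation[OF b] steps_valuations[OF f] by auto
  have p: "0 \<le> p" "p \<le> 1" using mix_nonneg[OF a] mix_nonneg[OF b] by auto
  show ?thesis
  proof (cases "a = \<tau>")
    case True
    have "\<exists>\<psi>. (\<forall>y. \<alpha> y + \<beta> y \<noteq> 0 \<longrightarrow> \<psi> y \<in> {\<xi>. weak_trans \<tau> f n y \<tau> \<xi>}) \<and>
        (\<lambda>z. bind \<alpha> \<theta>\<tau> z + bind \<beta> \<theta>a z) = bind (\<lambda>y. \<alpha> y + \<beta> y) \<psi>"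
      by (rule bind_merge[OF va vb conv]) (use \<theta>\<tau> \<theta>a True in auto)
    then obtain \<psi> where \<psi>: "\<And>y. \<alpha> y + \<beta> y \<noteq> 0 \<Longrightarrow> weak_trans \<tau> f n y \<tau> (\<psi> y)"
      "(\<lambda>z. bind \<alpha> \<theta>\<tau> z + bind \<beta> \<theta>a z) = bind (\<lambda>y. \<alpha> y + \<beta> y) \<psi>" by blast
    \<comment> \<open>With both labels silent, the two parts form one combined step, entered below
      with \<open>p = 1\<close>; the other summand then has coefficient 0.\<close>
    have "mix (steps f x \<tau>) 1 (\<lambda>y. \<alpha> y + \<beta> y)" using mix_add[of _ p \<alpha> "1 - p" \<beta>] a b True by simp
    then show ?thesis
      unfolding weak_trans.simps \<psi>(2) combined_step_iff using True \<psi>(1)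
      by (intro exI[of _ 1] exI[of _ "\<lambda>y. \<alpha> y + \<beta> y"] exI[of _ \<psi>]) (auto simp: bind_def)
  next
    case False
    \<comment> \<open>At weight 0 the quotient defaults to 0, which is consistent because a
      combination of weight 0 vanishes.\<close>
    define \<zeta>a \<zeta>\<tau> where "\<zeta>a y = \<alpha> y / p" and "\<zeta>\<tau> y = \<beta> y / (1 - p)" for y
    have sa: "p * \<zeta>a y = \<alpha> y" for y
      using mix_zero_weight[OF a] by (cases "p = 0") (auto simp: \<zeta>a_def)
    have sb: "(1 - p) * \<zeta>\<tau> y = \<beta> y" for y
      using mix_zero_weight[OF b] by (cases "p = 1") (auto simp: \<zeta>\<tau>_def)
    have ca: "combined_step f x a \<zeta>a" if "p \<noteq> 0"
      using mix_scale[OF a, of "1 / p"] that p unfolding combined_step_iff \<zeta>a_def by simp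
    have cb: "combined_step f x \<tau> \<zeta>\<tau>" if "1 - p \<noteq> 0"
      using mix_scale[OF b, of "1 / (1 - p)"] that p unfolding combined_step_iff \<zeta>\<tau>_def by simp
    let ?S = "{y. \<alpha> y \<noteq> 0} \<union> {y. \<beta> y \<noteq> 0}"
    have fin: "finite ?S" using valuationsD(1)[OF va] valuationsD(1)[OF vb] by simp
    have "bind \<alpha> \<theta>\<tau> z + bind \<beta> \<theta>a z = Sum_any (\<lambda>y. \<alpha> y * \<theta>\<tau> y z + \<beta> y * \<theta>a y z)" for z
    proof -
      have "Sum_any (\<lambda>y. \<alpha> y * \<theta>\<tau> y z + \<beta> y * \<theta>a y z) = (\<Sum>y\<in>?S. \<alpha> y * \<theta>\<tau> y z + \<beta> y * \<theta>a y z)"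
        using fin by (intro Sum_any.expand_superset) auto
      moreover have "bind \<alpha> \<theta>\<tau> z = (\<Sum>y\<in>?S. \<alpha> y * \<theta>\<tau> y z)" "bind \<beta> \<theta>a z = (\<Sum>y\<in>?S. \<beta> y * \<theta>a y z)"
        by (rule bind_eq_sum[OF fin]; auto)+
      ultimately show ?thesis by (simp add: sum.distrib)
    qed
    then show ?thesis
      unfolding weak_trans.simps using p ca cb \<theta>\<tau> \<theta>a False
      by (intro exI[of _ p] exI[of _ \<zeta>a] exI[of _ \<zeta>\<tau>] exI[of _ \<theta>a] exI[of _ \<theta>\<tau>]) (simp add: sa sb)
  qed
qed

text \<open>Induction on the length. The first steps are mixed with weights \<open>t\<close> and
  \<open>1 - t\<close>, and the continuations are averaged pointwise by \<open>bind_merge\<close>,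
  where convexity at the smaller length is used. At length 0 there is at most one
  transition.\<close>

lemma convex_weak_trans:
  assumes f: "segala_system f"
  shows "convex {\<xi>. weak_trans \<tau> f n x a \<xi>}"
proof (induction n arbitrary: x a)
  case 0
  have "t * dirac x z + (1 - t) * dirac x z = dirac x z" for t z
    by (simp add: algebra_simps)
  then show ?case by (auto simp: convex_def)
next
  case (Suc n)
  show ?case
    unfolding convex_def
  proof (intro ballI allI impI, unfold mem_Collect_eq)
    fix \<xi>1 \<xi>2 and t :: real
    assume \<xi>1: "weak_trans \<tau> f (Suc n) x a \<xi>1" and \<xi>2: "weak_trans \<tau> f (Suc n) x a \<xi>2"
      and t: "0 \<le> t" "t \<le> 1"
    obtain p1 \<alpha>1 \<beta>1 \<theta>a1 \<theta>\<tau>1 where 1: "mix (steps f x a) p1 \<alpha>1" "mix (steps f x \<tau>) (1 - p1) \<beta>1"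
      "\<And>y. \<alpha>1 y \<noteq> 0 \<Longrightarrow> weak_trans \<tau> f n y \<tau> (\<theta>\<tau>1 y)"
      "\<And>y. \<beta>1 y \<noteq> 0 \<Longrightarrow> weak_trans \<tau> f n y a (\<theta>a1 y)"
      "\<xi>1 = (\<lambda>z. bind \<alpha>1 \<theta>\<tau>1 z + bind \<beta>1 \<theta>a1 z)" using weak_trans_SucD[OF f \<xi>1] by blast
    obtain p2 \<alpha>2 \<beta>2 \<theta>a2 \<theta>\<tau>2 where 2: "mix (steps f x a) p2 \<alpha>2" "mix (steps f x \<tau>) (1 - p2) \<beta>2"
      "\<And>y. \<alpha>2 y \<noteq> 0 \<Longrightarrow> weak_trans \<tau> f n y \<tau> (\<theta>\<tau>2 y)"
      "\<And>y. \<beta>2 y \<noteq> 0 \<Longrightarrow> weak_trans \<tau> f n y a (\<theta>a2 y)"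
      "\<xi>2 = (\<lambda>z. bind \<alpha>2 \<theta>\<tau>2 z + bind \<beta>2 \<theta>a2 z)" using weak_trans_SucD[OF f \<xi>2] by blast
    have v: "\<alpha>1 \<in> valuations UNIV" "\<beta>1 \<in> valuations UNIV"
      "\<alpha>2 \<in> valuations UNIV" "\<beta>2 \<in> valuations UNIV"
      using 1(1,2)[THEN mix_valuation, OF steps_valuations[OF f]]
        2(1,2)[THEN mix_valuation, OF steps_valuations[OF f]] by auto
    have sv: "(\<lambda>y. t * \<alpha>1 y) \<in> valuations UNIV" "(\<lambda>y. t * \<beta>1 y) \<in> valuations UNIV"
      "(\<lambda>y. (1 - t) * \<alpha>2 y) \<in> valuations UNIV" "(\<lambda>y. (1 - t) * \<beta>2 y) \<in> valuations UNIV"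
      using v t by (auto intro: scale_valuation)
    have "\<exists>\<psi>\<tau>. (\<forall>y. t * \<alpha>1 y + (1 - t) * \<alpha>2 y \<noteq> 0 \<longrightarrow> \<psi>\<tau> y \<in> {\<xi>. weak_trans \<tau> f n y \<tau> \<xi>}) \<and>
        (\<lambda>z. bind (\<lambda>y. t * \<alpha>1 y) \<theta>\<tau>1 z + bind (\<lambda>y. (1 - t) * \<alpha>2 y) \<theta>\<tau>2 z) =
        bind (\<lambda>y. t * \<alpha>1 y + (1 - t) * \<alpha>2 y) \<psi>\<tau>"
      by (rule bind_merge[OF sv(1,3) Suc.IH]) (use 1(3) 2(3) in auto)
    then obtain \<psi>\<tau> where \<psi>\<tau>: "\<And>y. t * \<alpha>1 y + (1 - t) * \<alpha>2 y \<noteq> 0 \<Longrightarrow> weak_trans \<tau> f n y \<tau> (\<psi>\<tau> y)"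
      "(\<lambda>z. bind (\<lambda>y. t * \<alpha>1 y) \<theta>\<tau>1 z + bind (\<lambda>y. (1 - t) * \<alpha>2 y) \<theta>\<tau>2 z) =
        bind (\<lambda>y. t * \<alpha>1 y + (1 - t) * \<alpha>2 y) \<psi>\<tau>" by blast
    have "\<exists>\<psi>a. (\<forall>y. t * \<beta>1 y + (1 - t) * \<beta>2 y \<noteq> 0 \<longrightarrow> \<psi>a y \<in> {\<xi>. weak_trans \<tau> f n y a \<xi>}) \<and>
        (\<lambda>z. bind (\<lambda>y. t * \<beta>1 y) \<theta>a1 z + bind (\<lambda>y. (1 - t) * \<beta>2 y) \<theta>a2 z) =
        bind (\<lambda>y. t * \<beta>1 y + (1 - t) * \<beta>2 y) \<psi>a"
      by (rule bind_merge[OF sv(2,4) Suc.IH]) (use 1(4) 2(4) in auto)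
    then obtain \<psi>a where \<psi>a: "\<And>y. t * \<beta>1 y + (1 - t) * \<beta>2 y \<noteq> 0 \<Longrightarrow> weak_trans \<tau> f n y a (\<psi>a y)"
      "(\<lambda>z. bind (\<lambda>y. t * \<beta>1 y) \<theta>a1 z + bind (\<lambda>y. (1 - t) * \<beta>2 y) \<theta>a2 z) =
        bind (\<lambda>y. t * \<beta>1 y + (1 - t) * \<beta>2 y) \<psi>a" by blast
    define p where "p = t * p1 + (1 - t) * p2"
    have "mix (steps f x a) p (\<lambda>y. t * \<alpha>1 y + (1 - t) * \<alpha>2 y)"
      unfolding p_def using t 1(1) 2(1) by (intro mix_add mix_scale) auto
    moreover have "mix (steps f x \<tau>) (t * (1 - p1) + (1 - t) * (1 - p2))
        (\<lambda>y. t * \<beta>1 y + (1 - t) * \<beta>2 y)"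
      using t 1(2) 2(2) by (intro mix_add mix_scale) auto
    moreover have "t * (1 - p1) + (1 - t) * (1 - p2) = 1 - p" by (simp add: p_def algebra_simps)
    ultimately have "weak_trans \<tau> f (Suc n) x a
       (\<lambda>z. bind (\<lambda>y. t * \<alpha>1 y + (1 - t) * \<alpha>2 y) \<psi>\<tau> z + bind (\<lambda>y. t * \<beta>1 y + (1 - t) * \<beta>2 y) \<psi>a z)"
      using \<psi>\<tau>(1) \<psi>a(1) by (intro weak_trans_SucI[OF f Suc.IH, where p = p]) auto
    moreover have "bind (\<lambda>y. t * \<alpha>1 y + (1 - t) * \<alpha>2 y) \<psi>\<tau> z + bind (\<lambda>y. t * \<beta>1 y + (1 - t) * \<beta>2 y) \<psi>a z
        = t * \<xi>1 z + (1 - t) * \<xi>2 z" for z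
      unfolding \<psi>\<tau>(2)[symmetric] \<psi>a(2)[symmetric] 1(5) 2(5)
      by (simp only: v[THEN bind_scale]) (simp add: algebra_simps)
    ultimately show "weak_trans \<tau> f (Suc n) x a (\<lambda>z. t * \<xi>1 z + (1 - t) * \<xi>2 z)" by simp
  qed
qed

text \<open>Idle first, then proceed: \<open>p = 0\<close> puts all weight on the silent step
  \<open>dirac x\<close>, after which \<open>a\<close> is still due.\<close>

lemma weak_trans_idle_Suc:
  assumes "weak_trans \<tau> (idle \<tau> f) n x a \<xi>"
  shows "weak_trans \<tau> (idle \<tau> f) (Suc n) x a \<xi>"
proof -
  have "combined_step (idle \<tau> f) x \<tau> (dirac x)"
    unfolding combined_step_iff by (rule mix_single_one) (simp add: steps_def idle_def)
  moreover have "Sum_any (\<lambda>y. dirac x y * \<xi> z) = \<xi> z" for z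
    using bind_dirac[of x "\<lambda>_. \<xi>"] by (simp add: bind_def fun_eq_iff)
  ultimately show ?thesis
    using assms unfolding weak_trans.simps
    by (intro exI[of _ 0] exI[of _ "dirac x"] exI[of _ "\<lambda>_. \<xi>"]) (auto simp: dirac_def)
qed

lemma weak_trans_idle_mono:
  "weak_trans \<tau> (idle \<tau> f) m x a \<xi> \<Longrightarrow> m \<le> n \<Longrightarrow> weak_trans \<tau> (idle \<tau> f) n x a \<xi>"
  by (rule dec_induct[where P = "\<lambda>n. weak_trans \<tau> (idle \<tau> f) n x a \<xi>"])
    (auto intro: weak_trans_idle_Suc simp del: weak_trans.simps)

section \<open>The weak pattern\<close>

text \<open>Indexing the nonempty members of the pattern by actions, with \<open>\<tau>\<close>
  standing for the silent language, matches them with the labels of weak transitions.\<close>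

definition weak_lang :: "'a \<Rightarrow> 'a \<Rightarrow> 'a list set" where
  "weak_lang \<tau> a = (if a = \<tau> then lists {\<tau>}
     else {u @ [a] @ v | u v. u \<in> lists {\<tau>} \<and> v \<in> lists {\<tau>}})"

lemma weak_pattern_eq: "weak_pattern \<tau> = insert {} (range (weak_lang \<tau>))"
  unfolding weak_pattern_def weak_lang_def by auto

lemma Nil_in_weak_lang: "[] \<in> weak_lang \<tau> a \<longleftrightarrow> a = \<tau>"
  by (auto simp: weak_lang_def)

lemma lang_quot_empty: "lang_quot {} a = {}"
  by (simp add: lang_quot_def)

text \<open>The pattern as an automaton. It runs parallel to the recursion of
  \<open>weak_trans\<close>: after \<open>a\<close> only silent moves remain, after
  \<open>\<tau>\<close> the label \<open>a\<close> is still due.\<close>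

lemma lang_quot_weak_lang:
  "lang_quot (weak_lang \<tau> a) c = (if c = \<tau> then weak_lang \<tau> a else if c = a then weak_lang \<tau> \<tau> else {})"
proof (cases "a = \<tau>")
  case True
  then show ?thesis by (auto simp: lang_quot_def weak_lang_def)
next
  case False
  have "c # w \<in> weak_lang \<tau> a \<longleftrightarrow> (c = \<tau> \<and> w \<in> weak_lang \<tau> a) \<or> (c = a \<and> w \<in> lists {\<tau>})" for w
  proof
    assume "c # w \<in> weak_lang \<tau> a"
    then obtain u v where uv: "c # w = u @ [a] @ v" "u \<in> lists {\<tau>}" "v \<in> lists {\<tau>}"
      using False by (auto simp: weak_lang_def)
    \<comment> \<open>The first letter belongs to \<open>u\<close> if \<open>u\<close> is nonempty
      and is the visible \<open>a\<close> otherwise.\<close>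
    then show "(c = \<tau> \<and> w \<in> weak_lang \<tau> a) \<or> (c = a \<and> w \<in> lists {\<tau>})"
      using False by (cases u) (auto simp: weak_lang_def)
  next
    assume "(c = \<tau> \<and> w \<in> weak_lang \<tau> a) \<or> (c = a \<and> w \<in> lists {\<tau>})"
    then show "c # w \<in> weak_lang \<tau> a"
    proof
      assume *: "c = \<tau> \<and> w \<in> weak_lang \<tau> a"
      then obtain u v where "w = u @ [a] @ v" "u \<in> lists {\<tau>}" "v \<in> lists {\<tau>}"
        using False by (auto simp: weak_lang_def)
      then have "c # w = (\<tau> # u) @ [a] @ v" "\<tau> # u \<in> lists {\<tau>}" "v \<in> lists {\<tau>}" using * by auto
      then show ?thesis using False unfolding weak_lang_def by (smt (verit) mem_Collect_eq)
    next
      assume "c = a \<and> w \<in> lists {\<tau>}"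
      then have "c # w = [] @ [a] @ w" "[] \<in> lists {\<tau>}" "w \<in> lists {\<tau>}" by auto
      then show ?thesis using False unfolding weak_lang_def by (smt (verit) mem_Collect_eq)
    qed
  qed
  then show ?thesis using False by (auto simp: lang_quot_def weak_lang_def[of \<tau> \<tau>])
qed

lemma lang_quot_weak_pattern: "b \<in> weak_pattern \<tau> \<Longrightarrow> lang_quot b a \<in> weak_pattern \<tau>"
  by (auto simp: weak_pattern_eq lang_quot_weak_lang lang_quot_empty split: if_splits)

lemma lang_quot_silent: "b \<in> weak_pattern \<tau> \<Longrightarrow> lang_quot b \<tau> = b"
  by (auto simp: weak_pattern_eq lang_quot_weak_lang lang_quot_empty)

section \<open>Observations as an inductive predicate\<close>

text \<open>A single step of \<open>f\<close> suffices in \<open>obs_step\<close>, since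
  \<open>obs_zero\<close> and \<open>obs_conv\<close> supply the subconvex combinations. The kernel
  there is total; off the support of \<open>\<xi>\<close> it can be filled with 0.\<close>

inductive obs :: "('x, 'a) segala \<Rightarrow> ('x \<Rightarrow> 'y) \<Rightarrow> 'x \<Rightarrow> 'a list set \<Rightarrow> ('y \<Rightarrow> real) \<Rightarrow> bool"
  for f h where
  obs_zero: "obs f h x b (\<lambda>_. 0)"
| obs_halt: "[] \<in> b \<Longrightarrow> obs f h x b (dirac (h x))"
| obs_step: "(\<xi>, a) \<in> f x \<Longrightarrow> \<forall>y. obs f h y (lang_quot b a) (\<theta> y) \<Longrightarrow> obs f h x b (bind \<xi> \<theta>)"
| obs_conv: "obs f h x b \<phi> \<Longrightarrow> obs f h x b \<psi> \<Longrightarrow> 0 \<le> t \<Longrightarrow> t \<le> 1 \<Longrightarrow>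
    obs f h x b (\<lambda>z. t * \<phi> z + (1 - t) * \<psi> z)"

lemma convex_obs: "convex {\<phi>. obs f h x b \<phi>}"
  by (auto simp: convex_def intro: obs_conv)

lemma obs_valuation:
  assumes f: "segala_system f" and h: "\<And>x. h x \<in> Y"
  shows "obs f h x b \<phi> \<Longrightarrow> \<phi> \<in> valuations Y"
proof (induction rule: obs.induct)
  case (obs_step \<xi> a x b \<theta>)
  then show ?case using distsD(1)[OF segala_dists[OF f]] by (blast intro: bind_valuation)
qed (auto intro: zero_valuation dirac_valuation h lincomb_valuation)

lemma obs_in_C0M:
  assumes "segala_system f" "\<And>x. h x \<in> Y"
  shows "{\<phi>. obs f h x b \<phi>} \<in> C0M Y"
  unfolding C0M_iff using obs_valuation[OF assms(1), of h Y] assms(2) by (auto intro: obs_zero convex_obs)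

section \<open>The coalgebra structure in terms of single steps\<close>

definition tag :: "('x \<Rightarrow> real) \<Rightarrow> 'a \<Rightarrow> 'x \<times> 'a \<Rightarrow> real" where
  "tag \<xi> a = (\<lambda>(x, c). (if c = a then 1 else 0) * \<xi> x)"

text \<open>The generators of \<open>kappa S\<close>, whose elements are the subconvex combinations
  of this set.\<close>

definition tags :: "(('x \<Rightarrow> real) \<times> 'a) set \<Rightarrow> ('x \<times> 'a \<Rightarrow> real) set" where
  "tags S = (\<lambda>(\<xi>, a). tag \<xi> a) ` S"

lemma supp_tag: "{p. tag \<xi> a p \<noteq> 0} = (\<lambda>x. (x, a)) ` {x. \<xi> x \<noteq> 0}"
  by (auto simp: tag_def split: if_splits)

lemma tag_valuation: "\<xi> \<in> valuations UNIV \<Longrightarrow> tag \<xi> a \<in> valuations UNIV"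
  using supp_tag[of \<xi> a] by (auto simp: valuations_def) (auto simp: tag_def)

lemma tags_valuations: "S \<subseteq> dists \<times> UNIV \<Longrightarrow> tags S \<subseteq> valuations UNIV"
  by (auto simp: tags_def dest!: subsetD intro!: tag_valuation dest: distsD(1))

lemma bind_tag:
  assumes "\<xi> \<in> valuations UNIV"
  shows "bind (tag \<xi> a) \<theta> = bind \<xi> (\<lambda>x. \<theta> (x, a))"
proof
  fix z
  let ?S = "{x. \<xi> x \<noteq> 0}"
  have fin: "finite ?S" using valuationsD(1)[OF assms] .
  have "bind (tag \<xi> a) \<theta> z = (\<Sum>p\<in>(\<lambda>x. (x, a)) ` ?S. tag \<xi> a p * \<theta> p z)"
    using fin by (intro bind_eq_sum) (auto simp: supp_tag)
  also have "\<dots> = (\<Sum>x\<in>?S. \<xi> x * \<theta> (x, a) z)"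
    by (subst sum.reindex) (auto simp: inj_on_def tag_def)
  also have "\<dots> = bind \<xi> (\<lambda>x. \<theta> (x, a)) z"
    by (rule bind_eq_sum[OF fin, symmetric]) simp
  finally show "bind (tag \<xi> a) \<theta> z = bind \<xi> (\<lambda>x. \<theta> (x, a)) z" .
qed

lemma kappaD:
  assumes "\<zeta> \<in> kappa S"
  obtains p where "p \<le> 1" "mix (tags S) p \<zeta>"
proof -
  obtain n r \<xi>s as where *: "\<forall>i<(n::nat). (\<xi>s i, as i) \<in> S \<and> 0 \<le> r i" "(\<Sum>i<n. r i) \<le> 1"
    and \<zeta>: "\<zeta> = (\<lambda>(x, a). \<Sum>i<n. r i * (if a = as i then 1 else 0) * \<xi>s i x)"
    using assms unfolding kappa_def by blast
  have "\<zeta> = (\<lambda>z. \<Sum>i<n. r i * tag (\<xi>s i) (as i) z)"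
    unfolding \<zeta> by (auto simp: fun_eq_iff tag_def mult.assoc)
  moreover have "mix (tags S) (\<Sum>i<n. r i) (\<lambda>z. \<Sum>i<n. r i * tag (\<xi>s i) (as i) z)"
    using * by (intro mix_sum) (force simp: tags_def)+
  ultimately show ?thesis using that *(2) by blast
qed

lemma tag_in_kappa: "(\<xi>, a) \<in> S \<Longrightarrow> tag \<xi> a \<in> kappa S"
  unfolding kappa_def tag_def
  by (rule CollectI, rule exI[of _ 1], rule exI[of _ "\<lambda>_. 1"], rule exI[of _ "\<lambda>_. \<xi>"],
      rule exI[of _ "\<lambda>_. a"]) auto

lemma C_ext_eq: "C_ext g S = {bind \<zeta> \<theta> | \<zeta> \<theta>. \<zeta> \<in> S \<and> (\<forall>y. \<theta> y \<in> g y)}"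
  by (simp add: C_ext_def bind_def)

lemma bind_in_C_ext_kappa:
  assumes "S \<subseteq> dists \<times> UNIV" "(\<xi>, a) \<in> S" "\<And>y. \<theta> y \<in> g (y, a)" "\<And>p. (\<lambda>_. 0) \<in> g p"
  shows "bind \<xi> \<theta> \<in> C_ext g (kappa S)"
proof -
  \<comment> \<open>\<open>C_ext\<close> wants a value at every pair; pairs with a label other than
    \<open>a\<close> have weight 0 in \<open>tag \<xi> a\<close> and receive 0.\<close>
  let ?\<theta> = "\<lambda>(y, c). if c = a then \<theta> y else (\<lambda>_. 0)"
  have "\<xi> \<in> valuations UNIV" using assms(1,2) by (auto intro: distsD(1))
  then have "bind \<xi> \<theta> = bind (tag \<xi> a) ?\<theta>" by (simp add: bind_tag)
  moreover have "\<forall>p. ?\<theta> p \<in> g p" using assms(3,4) by auto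
  ultimately show ?thesis unfolding C_ext_eq using tag_in_kappa[OF assms(2)] by blast
qed

lemma C_ext_kappa_valuations:
  assumes "S \<subseteq> dists \<times> UNIV" "\<And>p. g p \<subseteq> valuations Y"
  shows "C_ext g (kappa S) \<subseteq> valuations Y"
proof
  fix \<phi> assume "\<phi> \<in> C_ext g (kappa S)"
  then obtain \<zeta> \<theta> where *: "\<phi> = bind \<zeta> \<theta>" "\<zeta> \<in> kappa S" "\<And>y. \<theta> y \<in> g y" unfolding C_ext_eq by blast
  obtain p where "mix (tags S) p \<zeta>" using kappaD[OF *(2)] by blast
  then have "\<zeta> \<in> valuations UNIV" using tags_valuations[OF assms(1)] by (rule mix_valuation)
  then show "\<phi> \<in> valuations Y" unfolding *(1) using *(3) assms(2) by (blast intro: bind_valuation)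
qed

text \<open>As \<open>bind\<close> is linear in its first argument, an element over
  \<open>kappa (f x)\<close> is a subconvex combination of elements over single tagged steps, and
  those arise by \<open>obs_step\<close>.\<close>

lemma C_ext_obs:
  assumes f: "segala_system f"
  shows "C_ext (\<lambda>(y, a). {\<phi>. obs f h y (lang_quot b a) \<phi>}) (kappa (f x)) \<subseteq> {\<phi>. obs f h x b \<phi>}"
proof
  fix \<phi> assume "\<phi> \<in> C_ext (\<lambda>(y, a). {\<phi>. obs f h y (lang_quot b a) \<phi>}) (kappa (f x))"
  then obtain \<zeta> \<theta> where *: "\<phi> = bind \<zeta> \<theta>" "\<zeta> \<in> kappa (f x)"
    "\<And>y a. obs f h y (lang_quot b a) (\<theta> (y, a))" unfolding C_ext_eq by blast
  have S: "f x \<subseteq> dists \<times> UNIV" using f by (auto simp: segala_system_def)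
  obtain p where p: "p \<le> 1" "mix (tags (f x)) p \<zeta>" using kappaD[OF *(2)] by blast
  have "bind g \<theta> \<in> {\<phi>. obs f h x b \<phi>}" if g: "g \<in> tags (f x)" for g
  proof -
    obtain \<xi> a where g: "g = tag \<xi> a" "(\<xi>, a) \<in> f x" using g by (auto simp: tags_def)
    then have "\<xi> \<in> valuations UNIV" using distsD(1)[OF segala_dists[OF f]] by blast
    then show ?thesis unfolding g(1) using g(2) *(3) by (auto simp: bind_tag intro: obs_step)
  qed
  then have "mix {\<phi>. obs f h x b \<phi>} p \<phi>"
    unfolding *(1) by (rule mix_bind[OF p(2) tags_valuations[OF S]])
  then show "\<phi> \<in> {\<phi>. obs f h x b \<phi>}"
    using p(1) by (rule mix_subconvex) (auto intro: convex_obs obs_zero)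
qed

lemma obs_init_obs: "obs_init h b x \<subseteq> {\<phi>. obs f h x b \<phi>}"
proof -
  \<comment> \<open>Halting with weight \<open>r\<close> is a mixture of halting and 0.\<close>
  have "obs f h x b (\<lambda>z. r * dirac (h x) z)" if "[] \<in> b" "0 \<le> r" "r \<le> 1" for r
    using obs_conv[OF obs_halt[OF that(1)] obs_zero that(2,3)] by simp
  then show ?thesis by (auto simp: obs_init_def C_unit_def intro: obs_zero)
qed

lemma dirac_in_obs_init: "[] \<in> b \<Longrightarrow> dirac (h x) \<in> obs_init h b x"
  by (auto simp: obs_init_def C_unit_def intro: exI[of _ 1])

section \<open>Joins and the least solution\<close>

lemma C_join_upper:
  assumes "M \<union> N \<subseteq> valuations Y"
  shows "M \<union> N \<subseteq> C_join Y M N"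
proof -
  let ?U = "{K \<in> C0M Y. M \<union> N \<subseteq> K}"
  \<comment> \<open>The least upper bound is the intersection of all upper bounds; this largest one
    ensures that the intersection is over a nonempty family.\<close>
  have "valuations Y \<in> ?U"
    using assms unfolding C0M_iff by (auto simp: convex_def intro: zero_valuation lincomb_valuation)
  then have "\<Inter>?U \<in> C0M Y"
    unfolding C0M_iff by (auto simp: convex_def C0M_iff)
  then have "C_join Y M N = \<Inter>?U"
    unfolding C_join_def by (intro Least_equality) auto
  then show ?thesis by auto
qed

text \<open>The observations solve the defining equation. They form an upper bound by their closure
  properties. For minimality, a step has observations as continuations and so already lies in the
  \<open>C_ext\<close> part, while 0 and mixtures lie in \<open>K\<close> as a member of
  \<open>C0M\<close>.\<close>

lemma C_join_obs:
  assumes f: "segala_system f" and h: "\<And>x. h x \<in> Y"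
  shows "C_join Y (obs_init h b x) (C_ext (\<lambda>(y, a). {\<phi>. obs f h y (lang_quot b a) \<phi>}) (kappa (f x)))
    = {\<phi>. obs f h x b \<phi>}"
  unfolding C_join_def
proof (rule Least_equality)
  show "{\<phi>. obs f h x b \<phi>} \<in> C0M Y \<and> obs_init h b x \<union>
      C_ext (\<lambda>(y, a). {\<phi>. obs f h y (lang_quot b a) \<phi>}) (kappa (f x)) \<subseteq> {\<phi>. obs f h x b \<phi>}"
    using obs_in_C0M[OF f, of h Y] h obs_init_obs[of h b x f] C_ext_obs[OF f, of h b x] by simp
next
  fix K assume K: "K \<in> C0M Y \<and> obs_init h b x \<union>
      C_ext (\<lambda>(y, a). {\<phi>. obs f h y (lang_quot b a) \<phi>}) (kappa (f x)) \<subseteq> K"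
  then have K0: "(\<lambda>_. 0) \<in> K" and conv: "convex K" by (auto simp: C0M_iff)
  have "\<phi> \<in> K" if "obs f h x b \<phi>" for \<phi>
    using that K
  proof (induction x b \<phi> rule: obs.induct)
    case (obs_zero x b)
    show ?case by (rule K0)
  next
    case (obs_halt b x)
    then show ?case using dirac_in_obs_init[of b h x] by blast
  next
    case (obs_step \<xi> a x b \<theta>)
    have "f x \<subseteq> dists \<times> UNIV" using f by (auto simp: segala_system_def)
    then have "bind \<xi> \<theta> \<in> C_ext (\<lambda>(y, a). {\<phi>. obs f h y (lang_quot b a) \<phi>}) (kappa (f x))"
      using obs_step by (intro bind_in_C_ext_kappa) (auto intro: obs.obs_zero)
    then show ?case using obs_step.prems by blast
  next
    case (obs_conv x b \<phi> \<psi> t)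
    then show ?case using convexD[OF conv] by blast
  qed
  then show "{\<phi>. obs f h x b \<phi>} \<subseteq> K" by blast
qed

text \<open>Any other solution \<open>K\<close> is closed under the four rules of
  \<open>obs\<close>, hence contains every observation by induction.\<close>

lemma obs_map_kappa:
  assumes f: "segala_system f" and h: "\<And>x. h x \<in> Y"
    and B: "\<And>b a. b \<in> B \<Longrightarrow> lang_quot b a \<in> B"
  shows "obs_map B Y h (kappa \<circ> f) = (\<lambda>x. \<lambda>b\<in>B. {\<phi>. obs f h x b \<phi>})"
  unfolding obs_map_def
proof (rule Least_equality)
  let ?O = "\<lambda>x. \<lambda>b\<in>B. {\<phi>. obs f h x b \<phi>}"
  have "?O x \<in> B \<rightarrow>\<^sub>E C0M Y" for x
    using obs_in_C0M[OF f, of h Y] h by auto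
  moreover have "?O x b = C_join Y (obs_init h b x)
      (C_ext (\<lambda>(y, a). ?O y (lang_quot b a)) ((kappa \<circ> f) x))" if "b \<in> B" for x b
    using C_join_obs[OF f, of h Y b x] h that B by simp
  ultimately show "(\<forall>x. ?O x \<in> B \<rightarrow>\<^sub>E C0M Y) \<and> (\<forall>x. \<forall>b\<in>B. ?O x b =
      C_join Y (obs_init h b x) (C_ext (\<lambda>(y, a). ?O y (lang_quot b a)) ((kappa \<circ> f) x)))"
    by blast
next
  fix K assume K: "(\<forall>x. K x \<in> B \<rightarrow>\<^sub>E C0M Y) \<and> (\<forall>x. \<forall>b\<in>B. K x b =
      C_join Y (obs_init h b x) (C_ext (\<lambda>(y, a). K y (lang_quot b a)) ((kappa \<circ> f) x)))"
  have KC: "K x b \<in> C0M Y" if "b \<in> B" for x b using K that PiE_mem by blast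
  have sub: "obs_init h b x \<union> C_ext (\<lambda>(y, a). K y (lang_quot b a)) (kappa (f x)) \<subseteq> K x b"
    if "b \<in> B" for x b
  proof -
    have "f x \<subseteq> dists \<times> UNIV" using f by (auto simp: segala_system_def)
    then have "C_ext (\<lambda>(y, a). K y (lang_quot b a)) (kappa (f x)) \<subseteq> valuations Y"
      using KC[OF B[OF that]] by (intro C_ext_kappa_valuations) (auto simp: C0M_iff)
    moreover have "obs_init h b x \<subseteq> valuations Y"
      using obs_init_obs[of h b x f] obs_valuation[OF f, of h Y] h by blast
    ultimately show ?thesis using C_join_upper K that by (metis (no_types, lifting) Un_least comp_apply)
  qed
  have le: "\<phi> \<in> K x b" if "obs f h x b \<phi>" "b \<in> B" for x b \<phi>
    using that
  proof (induction rule: obs.induct)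
    case (obs_zero x b)
    then show ?case using KC by (auto simp: C0M_iff)
  next
    case (obs_halt b x)
    then show ?case using sub dirac_in_obs_init[of b h x] by blast
  next
    case (obs_step \<xi> a x b \<theta>)
    have "f x \<subseteq> dists \<times> UNIV" using f by (auto simp: segala_system_def)
    then have "bind \<xi> \<theta> \<in> C_ext (\<lambda>(y, a). K y (lang_quot b a)) (kappa (f x))"
      using obs_step B KC by (intro bind_in_C_ext_kappa) (auto simp: C0M_iff)
    then show ?case using sub[OF obs_step.prems] by blast
  next
    case (obs_conv x b \<phi> \<psi> t)
    then have "convex (K x b)" using KC by (auto simp: C0M_iff)
    then show ?case using obs_conv by (auto intro: convexD)
  qed
  have "(\<lambda>b\<in>B. {\<phi>. obs f h x b \<phi>}) b \<subseteq> K x b" for x b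
  proof (cases "b \<in> B")
    case True
    then show ?thesis using le by auto
  next
    case False
    \<comment> \<open>Outside \<open>B\<close> both maps are extensional and take the same default
      value.\<close>
    moreover have "K x b = undefined" using K False by (auto dest: PiE_arb)
    ultimately show ?thesis by simp
  qed
  then show "(\<lambda>x. \<lambda>b\<in>B. {\<phi>. obs f h x b \<phi>}) \<le> K" by (simp add: le_fun_def)
qed

lemma obs_bisim_iff:
  assumes f: "segala_system f"
  shows "obs_bisim (weak_pattern \<tau>) (kappa \<circ> f) E \<longleftrightarrow>
    (\<forall>x y. (x, y) \<in> E \<longrightarrow> (\<forall>b\<in>weak_pattern \<tau>. \<forall>\<phi>.
      obs f (\<lambda>x. E `` {x}) x b \<phi> \<longleftrightarrow> obs f (\<lambda>x. E `` {x}) y b \<phi>))"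
proof -
  have "obs_map (weak_pattern \<tau>) (UNIV // E) (\<lambda>x. E `` {x}) (kappa \<circ> f) =
      (\<lambda>x. \<lambda>b\<in>weak_pattern \<tau>. {\<phi>. obs f (\<lambda>x. E `` {x}) x b \<phi>})"
    by (rule obs_map_kappa[OF f]) (auto intro: quotientI lang_quot_weak_pattern)
  moreover have "restrict F B = restrict G B \<longleftrightarrow> (\<forall>b\<in>B. F b = G b)"
    for F G :: "'b list set \<Rightarrow> ('a set \<Rightarrow> real) set" and B
    by (metis restrict_apply' restrict_ext)
  ultimately show ?thesis unfolding obs_bisim_def by (simp add: set_eq_iff)
qed

section \<open>Weak bisimulations preserve observations\<close>

text \<open>Every summand is a step of \<open>f\<close> or the idle one. After idling the
  continuation \<open>\<theta> x\<close> is itself an observation of \<open>x\<close> for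
  \<open>b\<close>, because the silent quotient fixes \<open>b\<close>.\<close>

lemma obs_mix_step:
  assumes f: "segala_system f" and b: "lang_quot b \<tau> = b"
    and mix: "mix (steps (idle \<tau> f) x a) p \<alpha>" and \<theta>: "\<And>y. obs f h y (lang_quot b a) (\<theta> y)"
  shows "mix {\<phi>. obs f h x b \<phi>} p (bind \<alpha> \<theta>)"
proof (rule mix_bind[OF mix steps_valuations[OF segala_idle[OF f]]])
  fix g assume "g \<in> steps (idle \<tau> f) x a"
  then consider "g = dirac x" "a = \<tau>" | "(g, a) \<in> f x" by (auto simp: steps_def idle_def)
  then show "bind g \<theta> \<in> {\<phi>. obs f h x b \<phi>}"
  proof cases
    case 1
    then show ?thesis using \<theta>[of x] b by (simp add: bind_dirac)
  next
    case 2
    then show ?thesis using \<theta> by (auto intro: obs_step)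
  qed
qed

text \<open>Induction on the length. The branch that has performed \<open>a\<close> continues
  silently for \<open>lang_quot b a\<close>; the branch that was silent so far still owes
  \<open>a\<close> and continues for \<open>b\<close>.\<close>

lemma obs_weak_trans:
  assumes f: "segala_system f"
  shows "weak_trans \<tau> (idle \<tau> f) n x a \<xi> \<Longrightarrow> b \<in> weak_pattern \<tau> \<Longrightarrow>
    (\<And>y. obs f h y (lang_quot b a) (\<theta> y)) \<Longrightarrow> obs f h x b (bind \<xi> \<theta>)"
proof (induction n arbitrary: x a \<xi> b)
  case 0
  then show ?case by (simp add: bind_dirac lang_quot_silent)
next
  case (Suc n)
  let ?f = "idle \<tau> f"
  have f': "segala_system ?f" using f by (rule segala_idle)
  obtain p \<alpha> \<beta> \<theta>\<tau> \<theta>a where *: "mix (steps ?f x a) p \<alpha>" "mix (steps ?f x \<tau>) (1 - p) \<beta>"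
    "\<And>y. \<alpha> y \<noteq> 0 \<Longrightarrow> weak_trans \<tau> ?f n y \<tau> (\<theta>\<tau> y)"
    "\<And>y. \<beta> y \<noteq> 0 \<Longrightarrow> weak_trans \<tau> ?f n y a (\<theta>a y)"
    "\<xi> = (\<lambda>z. bind \<alpha> \<theta>\<tau> z + bind \<beta> \<theta>a z)" using weak_trans_SucD[OF f' Suc.prems(1)] by blast
  have v: "\<alpha> \<in> valuations UNIV" "\<beta> \<in> valuations UNIV"
    using *(1,2)[THEN mix_valuation, OF steps_valuations[OF f']] by auto
  have w: "\<theta>\<tau> y \<in> valuations UNIV" if "\<alpha> y \<noteq> 0" for y
    using weak_trans_valuation[OF f' *(3)[OF that]] .
  have w': "\<theta>a y \<in> valuations UNIV" if "\<beta> y \<noteq> 0" for y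
    using weak_trans_valuation[OF f' *(4)[OF that]] .
  \<comment> \<open>Off the support nothing is known about \<open>\<theta>\<tau> y\<close>; 0 is an
    observation there and leaves the \<open>bind\<close> unchanged.\<close>
  define \<omega>\<tau> where "\<omega>\<tau> y = (if \<alpha> y = 0 then (\<lambda>_. 0) else bind (\<theta>\<tau> y) \<theta>)" for y
  define \<omega>a where "\<omega>a y = (if \<beta> y = 0 then (\<lambda>_. 0) else bind (\<theta>a y) \<theta>)" for y
  have b: "lang_quot b \<tau> = b" "lang_quot b a \<in> weak_pattern \<tau>"
    using Suc.prems(2) by (rule lang_quot_silent, rule lang_quot_weak_pattern)
  have "obs f h y (lang_quot b a) (\<omega>\<tau> y)" for y
    using Suc.IH[OF *(3) b(2)] Suc.prems(3) lang_quot_silent[OF b(2)]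
    by (auto simp: \<omega>\<tau>_def intro: obs_zero)
  then have m1: "mix {\<phi>. obs f h x b \<phi>} p (bind \<alpha> \<omega>\<tau>)"
    by (rule obs_mix_step[OF f b(1) *(1)])
  have "obs f h y b (\<omega>a y)" for y
    using Suc.IH[OF *(4) Suc.prems(2)] Suc.prems(3) by (auto simp: \<omega>a_def intro: obs_zero)
  then have m2: "mix {\<phi>. obs f h x b \<phi>} (1 - p) (bind \<beta> \<omega>a)"
    by (intro obs_mix_step[OF f b(1) *(2)]) (simp add: b(1))
  have "bind \<xi> \<theta> = (\<lambda>z. bind (bind \<alpha> \<theta>\<tau>) \<theta> z + bind (bind \<beta> \<theta>a) \<theta> z)"
    unfolding *(5) using v w w'
    by (intro bind_add[where Y = UNIV and Z = UNIV] bind_valuation) auto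
  also have "bind (bind \<alpha> \<theta>\<tau>) \<theta> = bind \<alpha> \<omega>\<tau>"
    using bind_assoc[OF v(1), of \<theta>\<tau> UNIV \<theta>] w by (auto simp: \<omega>\<tau>_def intro: bind_cong)
  also have "bind (bind \<beta> \<theta>a) \<theta> = bind \<beta> \<omega>a"
    using bind_assoc[OF v(2), of \<theta>a UNIV \<theta>] w' by (auto simp: \<omega>a_def intro: bind_cong)
  finally have "mix {\<phi>. obs f h x b \<phi>} 1 (bind \<xi> \<theta>)" using mix_add[OF m1 m2] by simp
  then have "bind \<xi> \<theta> \<in> {\<phi>. obs f h x b \<phi>}" using convex_obs by (rule mix_one_convex)
  then show ?case by simp
qed

section \<open>Averaging kernels over equivalence classes\<close>

lemma mass_eq_sum:
  assumes "finite S" "{z. \<xi> z \<noteq> 0} \<subseteq> S"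
  shows "mass \<xi> C = (\<Sum>z\<in>S. if z \<in> C then \<xi> z else 0)"
  unfolding mass_def using assms by (intro Sum_any.expand_superset) auto

text \<open>A conditional expectation: \<open>\<theta>' z\<close> is the
  \<open>\<xi>\<close>-average of \<open>\<theta>\<close> over the class of \<open>z\<close>. It is
  constant on classes, so its integral depends on class masses only.\<close>

lemma redistribute_kernel:
  assumes E: "equiv UNIV E" and \<xi>: "\<xi> \<in> valuations UNIV" and \<xi>': "\<xi>' \<in> valuations UNIV"
    and mass: "\<forall>C \<in> UNIV // E. mass \<xi> C = mass \<xi>' C"
    and M: "\<And>z. convex (M z)" "\<And>z. (\<lambda>_. 0) \<in> M z"
    and \<theta>: "\<And>z z'. (z, z') \<in> E \<Longrightarrow> \<theta> z \<in> M z'"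
  shows "\<exists>\<theta>'. (\<forall>z. \<theta>' z \<in> M z) \<and> bind \<xi> \<theta> = bind \<xi>' \<theta>'"
proof -
  let ?S = "{z. \<xi> z \<noteq> 0}" and ?S' = "{z. \<xi>' z \<noteq> 0}"
  have fin: "finite ?S" "finite ?S'" using valuationsD(1) \<xi> \<xi>' by auto
  have nn: "0 \<le> \<xi> z" for z using valuationsD(3)[OF \<xi>] .
  define m where "m z = mass \<xi> (E `` {z})" for z
  have m: "m z = (\<Sum>y\<in>?S \<inter> E `` {z}. \<xi> y)" for z
    unfolding m_def mass_eq_sum[OF fin(1) subset_refl] using fin(1) by (simp add: sum.inter_restrict)
  have m': "m z = (\<Sum>y\<in>?S'. if (z, y) \<in> E then \<xi>' y else 0)" for z
  proof -
    have "m z = mass \<xi>' (E `` {z})" unfolding m_def using mass by (auto intro: quotientI)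
    then show ?thesis by (simp add: mass_eq_sum[OF fin(2) subset_refl])
  qed
  define \<theta>' where "\<theta>' z = (\<lambda>u. (\<Sum>y\<in>?S \<inter> E `` {z}. \<xi> y * \<theta> y u) / m z)" for z
  have sym: "(y, z) \<in> E \<longleftrightarrow> (z, y) \<in> E" for y z using E by (auto simp: equiv_def sym_def)
  have "\<theta>' z \<in> M z" for z
  proof (cases "m z = 0")
    \<comment> \<open>A class without mass has no average; division by zero gives 0, which
      \<open>M z\<close> contains.\<close>
    case True
    then show ?thesis using M(2) by (simp add: \<theta>'_def)
  next
    case False
    have "mix (M z) (m z) (\<lambda>u. \<Sum>y\<in>?S \<inter> E `` {z}. \<xi> y * \<theta> y u)"
      unfolding m using fin(1) nn \<theta> sym by (intro mix_sum) auto
    then show ?thesis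
      unfolding \<theta>'_def using False M(1) mix_nonneg by (intro mix_convex) fastforce+
  qed
  moreover have "bind \<xi> \<theta> u = bind \<xi>' \<theta>' u" for u
  proof -
    have cls: "m y = m z" if "(z, y) \<in> E" for y z
      unfolding m_def using equiv_class_eq[OF E that] by simp
    have pos: "m z \<noteq> 0" if "z \<in> ?S" for z
    proof -
      have "z \<in> ?S \<inter> E `` {z}" using that E by (auto simp: equiv_def refl_on_def)
      then have "\<xi> z \<le> m z" unfolding m using fin(1) nn by (intro member_le_sum) auto
      moreover have "\<xi> z > 0" using that nn[of z] by simp
      ultimately show ?thesis by linarith
    qed
    have "bind \<xi>' \<theta>' u = (\<Sum>z'\<in>?S'. \<xi>' z' * ((\<Sum>z\<in>?S. if (z', z) \<in> E then \<xi> z * \<theta> z u else 0) / m z'))"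
      unfolding bind_eq_sum[OF fin(2) subset_refl] \<theta>'_def using fin(1)
      by (simp add: sum.inter_restrict)
    \<comment> \<open>Related points have equal \<open>m\<close>, so the denominator can follow
      \<open>z\<close>. After the swap the inner sum is the \<open>\<xi>'\<close>-mass of the class
      of \<open>z\<close>, which is \<open>m z\<close> by \<open>m'\<close>.\<close>
    also have "\<dots> = (\<Sum>z'\<in>?S'. \<Sum>z\<in>?S. (\<xi> z * \<theta> z u) * ((if (z, z') \<in> E then \<xi>' z' else 0) / m z))"
      unfolding sum_divide_distrib sum_distrib_left
      by (intro sum.cong refl) (auto simp: sym cls)
    also have "\<dots> = (\<Sum>z\<in>?S. (\<xi> z * \<theta> z u) * (m z / m z))"
      by (subst sum.swap) (simp only: m'[symmetric] sum_divide_distrib[symmetric] sum_distrib_left[symmetric])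
    also have "\<dots> = (\<Sum>z\<in>?S. \<xi> z * \<theta> z u)"
      by (intro sum.cong refl) (use pos in auto)
    also have "\<dots> = bind \<xi> \<theta> u" by (rule bind_eq_sum[OF fin(1) subset_refl, symmetric])
    finally show ?thesis by simp
  qed
  ultimately show ?thesis by blast
qed

lemma obs_weak_prob_bisim:
  assumes f: "segala_system f" and E: "equiv UNIV E" and wb: "weak_prob_bisim \<tau> f E"
  shows "obs f (\<lambda>x. E `` {x}) x b \<phi> \<Longrightarrow> b \<in> weak_pattern \<tau> \<Longrightarrow> (x, y) \<in> E \<Longrightarrow>
    obs f (\<lambda>x. E `` {x}) y b \<phi>"
proof (induction arbitrary: y rule: obs.induct)
  case (obs_zero x b)
  show ?case by (rule obs.obs_zero)
next
  case (obs_halt b x)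
  then show ?case using obs.obs_halt[of b f "\<lambda>x. E `` {x}" y] equiv_class_eq[OF E] by simp
next
  case (obs_step \<xi> a x b \<theta>)
  let ?h = "\<lambda>x. E `` {x}"
  obtain n \<xi>' where w: "weak_trans \<tau> (idle \<tau> f) n y a \<xi>'"
    and mass: "\<forall>C \<in> UNIV // E. mass \<xi> C = mass \<xi>' C"
    using wb obs_step.hyps(1) obs_step.prems(2) unfolding weak_prob_bisim_def by metis
  have v: "\<xi> \<in> valuations UNIV" "\<xi>' \<in> valuations UNIV"
    using distsD(1)[OF segala_dists[OF f obs_step.hyps(1)]]
      weak_trans_valuation[OF segala_idle[OF f] w] by auto
  \<comment> \<open>The induction hypothesis covers all states equivalent to \<open>z\<close>, which
    is what averaging over the class requires.\<close>
  have "obs f ?h z' (lang_quot b a) (\<theta> z)" if "(z, z') \<in> E" for z z'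
    using obs_step.IH lang_quot_weak_pattern[OF obs_step.prems(1)] that by simp
  then have "\<exists>\<theta>'. (\<forall>z. \<theta>' z \<in> {\<phi>. obs f ?h z (lang_quot b a) \<phi>}) \<and> bind \<xi> \<theta> = bind \<xi>' \<theta>'"
    by (intro redistribute_kernel[OF E v mass]) (auto intro: convex_obs obs.obs_zero)
  then obtain \<theta>' where "\<And>z. obs f ?h z (lang_quot b a) (\<theta>' z)" "bind \<xi> \<theta> = bind \<xi>' \<theta>'" by blast
  then show ?case using obs_weak_trans[OF f w obs_step.prems(1), of ?h \<theta>'] by simp
next
  case (obs_conv x b \<phi> \<psi> t)
  then show ?case by (auto intro: obs.obs_conv)
qed

section \<open>Observations of total mass one\<close>

text \<open>Halting is impossible, and quotients of the empty language remain empty.\<close>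

lemma obs_empty: "obs f h x b \<phi> \<Longrightarrow> b = {} \<Longrightarrow> \<phi> = (\<lambda>_. 0)"
proof (induction rule: obs.induct)
  case (obs_step \<xi> a x b \<theta>)
  then show ?case by (simp add: lang_quot_empty bind_def)
qed auto

lemma dist_average_le_one:
  assumes "\<xi> \<in> dists" "\<And>y. \<xi> y \<noteq> 0 \<Longrightarrow> s y \<le> 1"
  shows "Sum_any (\<lambda>y. \<xi> y * s y) \<le> 1"
    and "Sum_any (\<lambda>y. \<xi> y * s y) = 1 \<Longrightarrow> \<xi> y \<noteq> 0 \<Longrightarrow> s y = 1"
proof -
  let ?S = "{y. \<xi> y \<noteq> 0}"
  have v: "\<xi> \<in> valuations UNIV" using distsD(1)[OF assms(1)] .
  have fin: "finite ?S" using valuationsD(1)[OF v] .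
  have nn: "0 \<le> \<xi> y" for y using valuationsD(3)[OF v] .
  have one: "(\<Sum>y\<in>?S. \<xi> y) = 1"
    using distsD(2)[OF assms(1)] by (simp add: Sum_any.expand_set)
  have eq: "Sum_any (\<lambda>y. \<xi> y * s y) = (\<Sum>y\<in>?S. \<xi> y * s y)"
    using fin by (intro Sum_any.expand_superset) auto
  have le: "\<xi> y * s y \<le> \<xi> y" if "y \<in> ?S" for y
    using mult_left_mono[OF assms(2) nn, of y y] that by simp
  show "Sum_any (\<lambda>y. \<xi> y * s y) \<le> 1"
    unfolding eq one[symmetric] by (rule sum_mono[OF le])
  assume "Sum_any (\<lambda>y. \<xi> y * s y) = 1" and y: "\<xi> y \<noteq> 0"
  \<comment> \<open>The deficits are nonnegative and sum to 0, so each of them is 0.\<close>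
  then have "(\<Sum>y\<in>?S. \<xi> y - \<xi> y * s y) = 0" by (simp add: sum_subtractf one eq)
  then have "\<xi> y - \<xi> y * s y = 0"
    using sum_nonneg_eq_0_iff[OF fin, of "\<lambda>y. \<xi> y - \<xi> y * s y"] le y by force
  then show "s y = 1" using y by (simp add: algebra_simps)
qed

lemma obs_total_le_one:
  assumes f: "segala_system f"
  shows "obs f h x b \<phi> \<Longrightarrow> Sum_any \<phi> \<le> 1"
proof (induction rule: obs.induct)
  case (obs_zero x b)
  then show ?case by simp
next
  case (obs_halt b x)
  then show ?case by (simp add: Sum_any_dirac)
next
  case (obs_step \<xi> a x b \<theta>)
  have \<xi>: "\<xi> \<in> dists" using segala_dists[OF f obs_step.hyps] .
  have "\<theta> y \<in> valuations UNIV" for y using obs_valuation[OF f, of h UNIV] obs_step.IH by auto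
  then show ?case
    using dist_average_le_one(1)[OF \<xi>] obs_step.IH Sum_any_bind[OF distsD(1)[OF \<xi>], of \<theta> UNIV] by simp
next
  case (obs_conv x b \<phi> \<psi> t)
  have "\<phi> \<in> valuations UNIV" "\<psi> \<in> valuations UNIV"
    using obs_valuation[OF f, of h UNIV] obs_conv.hyps by auto
  then show ?case
    using convex_bound_le[OF obs_conv.IH, of t "1 - t"] obs_conv.hyps by (simp add: Sum_any_lincomb)
qed

text \<open>Mass 1 forces equality in \<open>obs_total_le_one\<close> at every rule, so every part
  of positive weight again has mass 1 and the induction hypothesis applies to it.\<close>

lemma obs_total_one_weak_trans:
  assumes f: "segala_system f"
  shows "obs f h x b \<phi> \<Longrightarrow> b = weak_lang \<tau> c \<Longrightarrow> Sum_any \<phi> = 1 \<Longrightarrow>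
    \<exists>n \<xi>. weak_trans \<tau> (idle \<tau> f) n x c \<xi> \<and> \<phi> = bind \<xi> (\<lambda>y. dirac (h y))"
proof (induction arbitrary: c rule: obs.induct)
  case (obs_zero x b)
  then show ?case by simp
next
  case (obs_halt b x)
  then have "c = \<tau>" by (simp add: Nil_in_weak_lang)
  then show ?case by (intro exI[of _ 0] exI[of _ "dirac x"]) (simp add: bind_dirac)
next
  case (obs_step \<xi> a x b \<theta>)
  let ?f = "idle \<tau> f" and ?D = "\<lambda>y. dirac (h y)"
  have f': "segala_system ?f" using f by (rule segala_idle)
  have \<xi>: "\<xi> \<in> dists" using segala_dists[OF f obs_step.hyps] .
  have v: "\<xi> \<in> valuations UNIV" using distsD(1)[OF \<xi>] .
  have fin: "finite {y. \<xi> y \<noteq> 0}" using valuationsD(1)[OF v] .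
  have "\<theta> y \<in> valuations UNIV" for y using obs_valuation[OF f, of h UNIV] obs_step.IH by auto
  then have "Sum_any (\<lambda>y. \<xi> y * Sum_any (\<theta> y)) = 1"
    using obs_step.prems(2) Sum_any_bind[OF v, of \<theta> UNIV] by simp
  then have one: "Sum_any (\<theta> y) = 1" if "\<xi> y \<noteq> 0" for y
    using dist_average_le_one(2)[OF \<xi>, of "\<lambda>y. Sum_any (\<theta> y)"] obs_total_le_one[OF f] obs_step.IH that
    by blast
  obtain y0 where y0: "\<xi> y0 \<noteq> 0" using distsD(2)[OF \<xi>] by (cases "\<forall>y. \<xi> y = 0") auto
  \<comment> \<open>A continuation of mass 1 excludes the empty language, hence any label other than
    \<open>\<tau>\<close> and \<open>c\<close>.\<close>
  have "lang_quot b a \<noteq> {}"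
    using obs_empty[of f h y0 "lang_quot b a" "\<theta> y0"] obs_step.IH one[OF y0] by auto
  then have ac: "a = \<tau> \<or> a = c"
    unfolding obs_step.prems(1) lang_quot_weak_lang by (auto split: if_splits)
  \<comment> \<open>The label still due after the step: \<open>c\<close> after a silent step,
    otherwise \<open>\<tau>\<close> since \<open>c\<close> has just been performed.\<close>
  define d where "d = (if a = \<tau> then c else \<tau>)"
  have d: "lang_quot b a = weak_lang \<tau> d"
    using ac unfolding obs_step.prems(1) lang_quot_weak_lang d_def by auto
  have "\<exists>n \<omega>. weak_trans \<tau> ?f n y d \<omega> \<and> \<theta> y = bind \<omega> ?D" if "\<xi> y \<noteq> 0" for y
    using obs_step.IH d one[OF that] by blast
  then obtain n \<omega> where *: "\<And>y. \<xi> y \<noteq> 0 \<Longrightarrow> weak_trans \<tau> ?f (n y) y d (\<omega> y)"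
    "\<And>y. \<xi> y \<noteq> 0 \<Longrightarrow> \<theta> y = bind (\<omega> y) ?D" by metis
  \<comment> \<open>A common bound for the finitely many lengths; idling pads each continuation to
    it.\<close>
  define N where "N = (\<Sum>y | \<xi> y \<noteq> 0. n y)"
  have "n y \<le> N" if "\<xi> y \<noteq> 0" for y
    unfolding N_def using fin that by (intro member_le_sum) auto
  then have w: "weak_trans \<tau> ?f N y d (\<omega> y)" if "\<xi> y \<noteq> 0" for y
    using weak_trans_idle_mono[OF *(1)] that by blast
  have step: "mix (steps ?f x a) 1 \<xi>"
    using obs_step.hyps by (intro mix_single_one) (simp add: steps_def idle_def)
  \<comment> \<open>A silent first step is the branch with \<open>p = 0\<close>, a visible one the
    branch with \<open>p = 1\<close>.\<close>
  have "weak_trans \<tau> ?f (Suc N) x c (bind \<xi> \<omega>)"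
  proof (cases "a = \<tau>")
    case True
    then show ?thesis
      using weak_trans_SucI[OF f' convex_weak_trans[OF f'], where x = x and a = c and p = 0 and
           \<alpha> = "\<lambda>_. 0" and \<beta> = \<xi> and n = N and \<theta>a = \<omega>]
        mix_zero step w
      by (auto simp add: bind_zero d_def simp del: weak_trans.simps)
  next
    case False
    then show ?thesis
      using weak_trans_SucI[OF f' convex_weak_trans[OF f'], where x = x and a = c and p = 1 and
           \<alpha> = \<xi> and \<beta> = "\<lambda>_. 0" and n = N and \<theta>\<tau> = \<omega>]
        mix_zero step w ac
      by (auto simp add: bind_zero d_def simp del: weak_trans.simps)
  qed
  moreover have "bind \<xi> \<theta> = bind (bind \<xi> \<omega>) ?D"
    using bind_assoc[OF v, of \<omega> UNIV ?D] weak_trans_valuation[OF f' w] *(2)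
      bind_cong[of \<xi> \<theta> "\<lambda>y. bind (\<omega> y) ?D"] by simp
  ultimately show ?case by blast
next
  case (obs_conv x b \<phi> \<psi> t)
  let ?f = "idle \<tau> f" and ?D = "\<lambda>y. dirac (h y)"
  have f': "segala_system ?f" using f by (rule segala_idle)
  have "\<phi> \<in> valuations UNIV" "\<psi> \<in> valuations UNIV"
    using obs_valuation[OF f, of h UNIV] obs_conv.hyps by auto
  then have tot: "t * Sum_any \<phi> + (1 - t) * Sum_any \<psi> = 1"
    using obs_conv.prems(2) by (simp add: Sum_any_lincomb)
  have le: "Sum_any \<phi> \<le> 1" "Sum_any \<psi> \<le> 1" using obs_total_le_one[OF f] obs_conv.hyps by auto
  \<comment> \<open>At the end points one part has weight 0 and its mass is unconstrained, so only
    the other part is used.\<close>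
  consider "t = 0" | "t = 1" | "0 < t" "t < 1" using obs_conv.hyps by linarith
  then show ?case
  proof cases
    case 1
    then show ?thesis using obs_conv.IH(2)[OF obs_conv.prems(1)] tot by simp
  next
    case 2
    then show ?thesis using obs_conv.IH(1)[OF obs_conv.prems(1)] tot by simp
  next
    case 3
    have "t * (1 - Sum_any \<phi>) + (1 - t) * (1 - Sum_any \<psi>) = 0"
      using tot by (simp add: algebra_simps)
    moreover have "0 \<le> t * (1 - Sum_any \<phi>)" "0 \<le> (1 - t) * (1 - Sum_any \<psi>)" using 3 le by auto
    ultimately have "t * (1 - Sum_any \<phi>) = 0" "(1 - t) * (1 - Sum_any \<psi>) = 0" by linarith+
    then have "Sum_any \<phi> = 1" "Sum_any \<psi> = 1" using 3 by auto
    then obtain m n \<xi> \<zeta> where w: "weak_trans \<tau> ?f m x c \<xi>" "weak_trans \<tau> ?f n x c \<zeta>"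
      and eq: "\<phi> = bind \<xi> ?D" "\<psi> = bind \<zeta> ?D"
      using obs_conv.IH[OF obs_conv.prems(1)] by blast
    have "weak_trans \<tau> ?f (m + n) x c \<xi>" "weak_trans \<tau> ?f (m + n) x c \<zeta>"
      using weak_trans_idle_mono[OF w(1)] weak_trans_idle_mono[OF w(2)] by auto
    then have "weak_trans \<tau> ?f (m + n) x c (\<lambda>z. t * \<xi> z + (1 - t) * \<zeta> z)"
      using convexD[OF convex_weak_trans[OF f', of \<tau> "m + n" x c], of \<xi> \<zeta> t] 3 by simp
    moreover have "(\<lambda>z. t * \<phi> z + (1 - t) * \<psi> z) = bind (\<lambda>z. t * \<xi> z + (1 - t) * \<zeta> z) ?D"
      unfolding eq using w[THEN weak_trans_valuation[OF f']] by (simp add: bind_lincomb)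
    ultimately show ?thesis by blast
  qed
qed

section \<open>Class masses and the equivalence of the two bisimulations\<close>

lemma bind_class_eq_mass:
  assumes E: "equiv UNIV E" and "C \<in> UNIV // E"
  shows "bind \<xi> (\<lambda>x. dirac (E `` {x})) C = mass \<xi> C"
proof -
  \<comment> \<open>The points sent to \<open>C\<close> by the projection are its own elements, so
    the image valuation at \<open>C\<close> is the class mass.\<close>
  have "C = E `` {x} \<longleftrightarrow> x \<in> C" for x
    using assms by (metis Image_singleton_iff UNIV_I equiv_class_eq_iff equiv_class_self quotientE)
  then show ?thesis unfolding bind_def mass_def dirac_def
    by (intro arg_cong[of _ _ Sum_any]) (auto simp: fun_eq_iff)
qed

theorem theorem25:
  fixes f :: "'x \<Rightarrow> (('x \<Rightarrow> real) \<times> 'a) set" and \<tau> :: 'a and E :: "('x \<times> 'x) set"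
  assumes "segala_system f"
    and "equiv UNIV E"
  shows "weak_prob_bisim \<tau> f E \<longleftrightarrow> obs_bisim (weak_pattern \<tau>) (kappa \<circ> f) E"
proof
  assume "weak_prob_bisim \<tau> f E"
  \<comment> \<open>Preservation yields one inclusion between the observations; symmetry of
    \<open>E\<close> yields the other.\<close>
  moreover have "(y, x) \<in> E" if "(x, y) \<in> E" for x y using that assms(2) by (auto simp: equiv_def sym_def)
  ultimately show "obs_bisim (weak_pattern \<tau>) (kappa \<circ> f) E"
    unfolding obs_bisim_iff[OF assms(1)] using obs_weak_prob_bisim[OF assms] by blast
next
  let ?h = "\<lambda>x. E `` {x}"
  assume ob: "obs_bisim (weak_pattern \<tau>) (kappa \<circ> f) E"
  show "weak_prob_bisim \<tau> f E"
    unfolding weak_prob_bisim_def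
  proof (intro allI impI)
    fix x y a \<xi> assume xy: "(x, y) \<in> E" and \<xi>: "(\<xi>, a) \<in> f x"
    let ?\<phi> = "bind \<xi> (\<lambda>z. dirac (?h z))"
    have d: "\<xi> \<in> dists" using segala_dists[OF assms(1) \<xi>] .
    \<comment> \<open>After \<open>a\<close> the remaining language is the silent one, so halting at
      once is allowed and the image of \<open>\<xi>\<close> in the quotient is an
      observation.\<close>
    have "[] \<in> lang_quot (weak_lang \<tau> a) a" by (simp add: lang_quot_weak_lang Nil_in_weak_lang)
    then have "obs f ?h x (weak_lang \<tau> a) ?\<phi>" using \<xi> by (auto intro: obs_step obs_halt)
    then have "obs f ?h y (weak_lang \<tau> a) ?\<phi>"
      using ob xy unfolding obs_bisim_iff[OF assms(1)] by (simp add: weak_pattern_eq)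
    moreover have "Sum_any ?\<phi> = 1"
      using Sum_any_bind[OF distsD(1)[OF d], of "\<lambda>z. dirac (?h z)" UNIV] distsD(2)[OF d]
      by (simp add: dirac_valuation Sum_any_dirac)
    ultimately obtain n \<xi>' where "weak_trans \<tau> (idle \<tau> f) n y a \<xi>'"
      and eq: "?\<phi> = bind \<xi>' (\<lambda>z. dirac (?h z))"
      using obs_total_one_weak_trans[OF assms(1)] by blast
    moreover have "mass \<xi> C = mass \<xi>' C" if "C \<in> UNIV // E" for C
      using bind_class_eq_mass[OF assms(2) that, of \<xi>] bind_class_eq_mass[OF assms(2) that, of \<xi>'] eq
      by simp
    ultimately show "\<exists>n \<xi>'. weak_trans \<tau> (idle \<tau> f) n y a \<xi>' \<and> (\<forall>C\<in>UNIV // E. mass \<xi> C = mass \<xi>' C)"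
      by blast
  qed
qed

end
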